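(* Assume $T_1\equiv 1$, $r_\perp\in(0,1)$, $r_\parallel\in(0,2)$, $r_\parallel(2-r_\parallel) = r_\perp$, and $0<T_2(x)<1$ for all $x\in[0,1]\times\{0\}$. For all $(x,v)\in\Omega\times\mathbb{R}^2$ with $x=(x_1,x_2)$, $v=(v_1,v_2)$, let $$f_\infty(x,v) = \beta\Big(\mathbf{1}_{\{v_2<0\}}\frac{e^{-\frac{|v|^2}{2}}}{\sqrt{2\pi}} + \mathbf{1}_{\{v_2>0\}}\int_{\{u\in\mathbb{R}^2 : u_2<0\}}(-u_2)\,R\big(u\to v;T_2(\tilde q(x,-v))\big)\frac{e^{-\frac{|u|^2}{2}}}{\sqrt{2\pi}}\,\mathrm{d}u\Big),$$ where $\beta>0$ is chosen so that $\int_{\Omega\times\mathbb{R}^2}f_\infty(x,v)\,\mathrm{d}x\,\mathrm{d}v = 1$. Then $f_\infty$ is a steady state of the mixed free-transport problem described in the context. Moreover, for all $x\in\Omega$, $$\int_{\mathbb{R}^2}v\,f_\infty(x,v)\,\mathrm{d}v = 0.$$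
   Context: Let $\Omega = [0,1]\times[0,1]$, let $T_1>0$ and $T_2>0$ be the (continuous) wall temperatures at $x_2=1$ and $x_2=0$ respectively, and let $r_\perp,r_\parallel$ be accommodation coefficients. For $T>0$ and $u,v\in\mathbb{R}^2$ with $u_2<0$, $v_2>0$, set $$R(u\to v;T) = \frac{1}{T r_\perp\sqrt{2\pi T r_\parallel(2-r_\parallel)}}\,e^{-\frac{|v_2|^2+(1-r_\perp)|u_2|^2}{2Tr_\perp}}\,I_0\Big(\frac{(1-r_\perp)^{1/2}v_2u_2}{Tr_\perp}\Big)\,e^{-\frac{|v_1-(1-r_\parallel)u_1|^2}{2Tr_\parallel(2-r_\parallel)}},$$ with $I_0(y)=\frac1\pi\int_0^\pi e^{y\cos\phi}\,\mathrm{d}\phi$. The mixed free-transport problem is $\partial_tf+v\cdot\nabla_xf=0$ in $\mathbb{R}_+\times\Omega\times\mathbb{R}^2$ with the boundary conditions: (i) periodic in $x_1$: for $x_2\in[0,1]$, $v_2\in\mathbb{R}$, $f(t,(0,x_2),(v_1,v_2)) = f(t,(1,x_2),(v_1,v_2))$ if $v_1<0$, and $f(t,(1,x_2),(v_1,v_2)) = f(t,(0,x_2),(v_1,v_2))$ if $v_1>0$; (ii) diffuse at $x_2=1$: for $x_1\in[0,1]$ and $v_2<0$, with $x=(x_1,1)$, $f(t,x,v) = \frac{e^{-|v|^2/(2T_1(x))}}{T_1(x)\sqrt{2\pi T_1(x)}}\int_{\{w\in\mathbb{R}^2 : w_2>0\}}w_2f(t,x,w)\,\mathrm{d}w$; (iii)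 Cercignani-Lampis at $x_2=0$: for $x_1\in[0,1]$ and $v_2>0$, with $x=(x_1,0)$, $f(t,x,v) = \int_{\{w\in\mathbb{R}^2 : w_2<0\}}(-w_2)\,R(w\to v;T_2(x))\,f(t,x,w)\,\mathrm{d}w$. A steady state is a time-independent solution of this equation together with these boundary conditions (the boundary conditions being understood almost everywhere on the boundary, and the transport equation in the weak sense). Define $\tilde\sigma(x,v) = \inf\{t>0 : x_2+tv_2=0\}$ if $x_2\in(0,1]$, $v_2<0$; $\tilde\sigma(x,v) = \inf\{t>0 : x_2+tv_2=1\}$ if $x_2\in[0,1)$, $v_2>0$; and $\tilde\sigma(x,v)=0$ otherwise. Define $$\tilde q(x,v) = \big(x_1+\tilde\sigma(x,v)v_1-[x_1+\tilde\sigma(x,v)v_1],\ x_2+\tilde\sigma(x,v)v_2\big)\in[0,1]^2,$$ where $[y]$ is the integer part (floor) of $y\in\mathbb{R}$. *)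

theory Defs
  imports "HOL-Analysis.Analysis"
begin

type_synonym plane = "real \<times> real"

text \<open>Phase-space densities are written \<open>f t x v\<close>, with position and velocity in the plane. The
  norm and inner product of \<open>real \<times> real\<close> are the Euclidean ones, and \<open>lborel\<close> on it is the
  two-dimensional Lebesgue measure.\<close>

definition Omega :: "plane set" where
  "Omega = {0..1} \<times> {0..1}"

subsection \<open>The Cercignani--Lampis kernel\<close>

text \<open>Modified Bessel function of the first kind, of order zero.\<close>

definition bessel_I0 :: "real \<Rightarrow> real" where
  "bessel_I0 y = 1 / pi * integral {0..pi} (\<lambda>\<phi>. exp (y * cos \<phi>))"

text \<open>Used only for incoming \<open>u\<close> and outgoing \<open>v\<close> at the lower wall: \<open>snd u < 0 < snd v\<close>.\<close>

definition CL_kernel :: "real \<Rightarrow> real \<Rightarrow> real \<Rightarrow> plane \<Rightarrow> plane \<Rightarrow> real" where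
  "CL_kernel r_perp r_par T u v =
     1 / (T * r_perp * sqrt (2 * pi * T * r_par * (2 - r_par)))
     * exp (- (((snd v)\<^sup>2 + (1 - r_perp) * (snd u)\<^sup>2) / (2 * T * r_perp)))
     * bessel_I0 (sqrt (1 - r_perp) * snd v * snd u / (T * r_perp))
     * exp (- ((fst v - (1 - r_par) * fst u)\<^sup>2 / (2 * T * r_par * (2 - r_par))))"

subsection \<open>Boundary conditions\<close>

text \<open>The values of \<open>f\<close> on the boundary of the square are its traces; the transport equation
  below ties them to the values in the interior.\<close>

definition periodic_bc :: "(real \<Rightarrow> plane \<Rightarrow> plane \<Rightarrow> real) \<Rightarrow> bool" where
  "periodic_bc f \<longleftrightarrow>
     (AE (t, x\<^sub>2, v) in (lborel :: (real \<times> real \<times> plane) measure).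
        0 < t \<longrightarrow> x\<^sub>2 \<in> {0..1} \<longrightarrow>
          (fst v < 0 \<longrightarrow> f t (0, x\<^sub>2) v = f t (1, x\<^sub>2) v) \<and>
          (fst v > 0 \<longrightarrow> f t (1, x\<^sub>2) v = f t (0, x\<^sub>2) v))"

definition diffuse_bc :: "(plane \<Rightarrow> real) \<Rightarrow> (real \<Rightarrow> plane \<Rightarrow> plane \<Rightarrow> real) \<Rightarrow> bool" where
  "diffuse_bc T\<^sub>1 f \<longleftrightarrow>
     (AE (t, x\<^sub>1, v) in (lborel :: (real \<times> real \<times> plane) measure).
        0 < t \<longrightarrow> x\<^sub>1 \<in> {0..1} \<longrightarrow> snd v < 0 \<longrightarrow>
          f t (x\<^sub>1, 1) v =
            exp (- ((norm v)\<^sup>2 / (2 * T\<^sub>1 (x\<^sub>1, 1)))) / (T\<^sub>1 (x\<^sub>1, 1) * sqrt (2 * pi * T\<^sub>1 (x\<^sub>1, 1)))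
            * (LINT w:{w. snd w > 0}|lborel. snd w * f t (x\<^sub>1, 1) w))"

definition CL_bc ::
  "real \<Rightarrow> real \<Rightarrow> (plane \<Rightarrow> real) \<Rightarrow> (real \<Rightarrow> plane \<Rightarrow> plane \<Rightarrow> real) \<Rightarrow> bool" where
  "CL_bc r_perp r_par T\<^sub>2 f \<longleftrightarrow>
     (AE (t, x\<^sub>1, v) in (lborel :: (real \<times> real \<times> plane) measure).
        0 < t \<longrightarrow> x\<^sub>1 \<in> {0..1} \<longrightarrow> snd v > 0 \<longrightarrow>
          f t (x\<^sub>1, 0) v =
            (LINT w:{w. snd w < 0}|lborel.
               (- snd w) * CL_kernel r_perp r_par (T\<^sub>2 (x\<^sub>1, 0)) w v * f t (x\<^sub>1, 0) w))"

subsection \<open>Weak form of the transport equation\<close>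

text \<open>Test functions: continuously differentiable, with compact support in
  \<open>{t > 0} \<times> \<real>\<^sup>2 \<times> \<real>\<^sup>2\<close>. They need not vanish on the boundary of the square.\<close>

definition test_function :: "(real \<times> plane \<times> plane \<Rightarrow> real) \<Rightarrow> bool" where
  "test_function \<phi> \<longleftrightarrow>
     (\<forall>z. \<phi> differentiable (at z)) \<and>
     (\<forall>h. continuous_on UNIV (\<lambda>z. frechet_derivative \<phi> (at z) h)) \<and>
     compact (closure {z. \<phi> z \<noteq> 0}) \<and>
     closure {z. \<phi> z \<noteq> 0} \<subseteq> {z. 0 < fst z}"

text \<open>For the side of the square parametrised by \<open>p\<close> on the unit interval, with outward unit
  normal \<open>n\<close>.\<close>

definition side_flux_integrable ::
  "(real \<Rightarrow> plane) \<Rightarrow> plane \<Rightarrow> (real \<Rightarrow> plane \<Rightarrow> plane \<Rightarrow> real) \<Rightarrow> bool" where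
  "side_flux_integrable p n f \<longleftrightarrow>
     (\<forall>\<tau>>0. set_integrable (lborel :: (real \<times> real \<times> plane) measure) ({0..\<tau>} \<times> {0..1} \<times> UNIV)
               (\<lambda>(t, s, v). (v \<bullet> n) * f t (p s) v))"

definition side_flux ::
  "(real \<Rightarrow> plane) \<Rightarrow> plane \<Rightarrow> (real \<Rightarrow> plane \<Rightarrow> plane \<Rightarrow> real)
     \<Rightarrow> (real \<times> plane \<times> plane \<Rightarrow> real) \<Rightarrow> real" where
  "side_flux p n f \<phi> =
     set_lebesgue_integral (lborel :: (real \<times> real \<times> plane) measure) ({0<..} \<times> {0..1} \<times> UNIV)
       (\<lambda>(t, s, v). (v \<bullet> n) * f t (p s) v * \<phi> (t, p s, v))"

text \<open>Green's identity for \<open>\<partial>\<^sub>t f + v \<cdot> \<nabla>\<^sub>x f = 0\<close>: the direction \<open>(1, v, 0)\<close> gives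
  \<open>\<partial>\<^sub>t \<phi> + v \<cdot> \<nabla>\<^sub>x \<phi>\<close>. Test functions supported in the open square give the equation in the
  sense of distributions; the others say that the boundary values of \<open>f\<close> are its traces.\<close>

definition weak_free_transport :: "(real \<Rightarrow> plane \<Rightarrow> plane \<Rightarrow> real) \<Rightarrow> bool" where
  "weak_free_transport f \<longleftrightarrow>
     (\<forall>\<tau>>0. set_integrable (lborel :: (real \<times> plane \<times> plane) measure) ({0..\<tau>} \<times> Omega \<times> UNIV)
               (\<lambda>(t, x, v). f t x v)) \<and>
     side_flux_integrable (\<lambda>s. (s, 1)) (0, 1) f \<and>
     side_flux_integrable (\<lambda>s. (s, 0)) (0, -1) f \<and>
     side_flux_integrable (\<lambda>s. (1, s)) (1, 0) f \<and>
     side_flux_integrable (\<lambda>s. (0, s)) (-1, 0) f \<and>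
     (\<forall>\<phi>. test_function \<phi> \<longrightarrow>
        set_lebesgue_integral (lborel :: (real \<times> plane \<times> plane) measure) ({0<..} \<times> Omega \<times> UNIV)
          (\<lambda>(t, x, v). f t x v * frechet_derivative \<phi> (at (t, x, v)) (1, v, 0))
        = side_flux (\<lambda>s. (s, 1)) (0, 1) f \<phi> + side_flux (\<lambda>s. (s, 0)) (0, -1) f \<phi>
          + side_flux (\<lambda>s. (1, s)) (1, 0) f \<phi> + side_flux (\<lambda>s. (0, s)) (-1, 0) f \<phi>)"

definition mixed_transport_solution ::
  "(plane \<Rightarrow> real) \<Rightarrow> (plane \<Rightarrow> real) \<Rightarrow> real \<Rightarrow> real
     \<Rightarrow> (real \<Rightarrow> plane \<Rightarrow> plane \<Rightarrow> real) \<Rightarrow> bool" where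
  "mixed_transport_solution T\<^sub>1 T\<^sub>2 r_perp r_par f \<longleftrightarrow>
     weak_free_transport f \<and> periodic_bc f \<and> diffuse_bc T\<^sub>1 f \<and> CL_bc r_perp r_par T\<^sub>2 f"

definition steady_state ::
  "(plane \<Rightarrow> real) \<Rightarrow> (plane \<Rightarrow> real) \<Rightarrow> real \<Rightarrow> real \<Rightarrow> (plane \<Rightarrow> plane \<Rightarrow> real) \<Rightarrow> bool" where
  "steady_state T\<^sub>1 T\<^sub>2 r_perp r_par g \<longleftrightarrow>
     mixed_transport_solution T\<^sub>1 T\<^sub>2 r_perp r_par (\<lambda>t. g)"

subsection \<open>The candidate steady state\<close>

definition sigma_tilde :: "plane \<Rightarrow> plane \<Rightarrow> real" where
  "sigma_tilde x v =
     (if snd x \<in> {0<..1} \<and> snd v < 0 then Inf {t. 0 < t \<and> snd x + t * snd v = 0}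
      else if snd x \<in> {0..<1} \<and> snd v > 0 then Inf {t. 0 < t \<and> snd x + t * snd v = 1}
      else 0)"

definition q_tilde :: "plane \<Rightarrow> plane \<Rightarrow> plane" where
  "q_tilde x v =
     (fst x + sigma_tilde x v * fst v - of_int \<lfloor>fst x + sigma_tilde x v * fst v\<rfloor>,
      snd x + sigma_tilde x v * snd v)"

definition f_infty ::
  "(plane \<Rightarrow> real) \<Rightarrow> real \<Rightarrow> real \<Rightarrow> real \<Rightarrow> plane \<Rightarrow> plane \<Rightarrow> real" where
  "f_infty T\<^sub>2 r_perp r_par \<beta> x v =
     \<beta> * (indicat_real {v. snd v < 0} v * (exp (- ((norm v)\<^sup>2 / 2)) / sqrt (2 * pi))
        + indicat_real {v. snd v > 0} v *
            (LINT u:{u. snd u < 0}|lborel.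
               (- snd u) * CL_kernel r_perp r_par (T\<^sub>2 (q_tilde x (- v))) u v
               * (exp (- ((norm u)\<^sup>2 / 2)) / sqrt (2 * pi))))"

definition total_mass :: "(plane \<Rightarrow> plane \<Rightarrow> real) \<Rightarrow> real" where
  "total_mass g = (LINT z:Omega \<times> UNIV|lborel. g (fst z) (snd z))"

end

theory Submission
  imports Defs "HOL-Probability.Distributions" "HOL-Real_Asymp.Real_Asymp"
begin

text \<open>A function that is constant along straight lines solves the free transport equation, and
\<open>f_infty\<close> is of this kind: a particle with \<open>v\<^sub>2 < 0\<close> carries the Maxwellian of the upper wall, a
particle with \<open>v\<^sub>2 > 0\<close> carries what the lower wall emits at the point where its backward
trajectory, wrapped around in \<open>x\<^sub>1\<close>, meets that wall. The lower boundary condition and the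
periodicity are therefore built into the formula. Two things remain to be understood: why the
upper wall receives the flux that it emits, although the temperature varies along the lower wall,
and why the equation holds in the weak sense although \<open>f_infty\<close> is in general discontinuous.

For the first, \<open>r_par * (2 - r_par) = r_perp\<close> makes the kernel act on both velocity components with
the same variance. Reflecting the Maxwellian of temperature 1 at a wall of temperature \<open>T\<close> gives
again a flux Maxwellian, of temperature \<open>S = 1 - r_perp + r_perp * T\<close>
(\<open>CL_reflects_maxwellian\<close>). For the normal component this is the integral of
\<open>s exp (- A s\<^sup>2 / 2) I\<^sub>0 (b s)\<close> (\<open>rayleigh_bessel_integral\<close>), computed from the power series of \<open>I\<^sub>0\<close>.
As seen from a fixed point, the temperature \<open>S\<close> depends on \<open>v\<close> only through the slope
\<open>m = v\<^sub>1 / v\<^sub>2\<close>, and the first velocity moment of a flux Maxwellian along the ray of slope \<open>m\<close> is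
\<open>(1 + m\<^sup>2) powr (- 3 / 2) / 2\<close>, whatever its temperature (\<open>wall_maxwellian_ray_integral\<close>). So the
moments over the half plane \<open>v\<^sub>2 > 0\<close> are those of a constant temperature: the flux is 1 and the
tangential momentum is 0 (\<open>half_plane_moments\<close>). This gives the diffuse condition and the vanishing
of the momentum.

For the second, fix \<open>t\<close> and \<open>v\<close>. The density is \<open>H (x\<^sub>1 - m x\<^sub>2)\<close> with \<open>H\<close> bounded and Borel. For
continuously differentiable \<open>H\<close>, Green's identity on the square is the fundamental theorem of
calculus in each coordinate, because \<open>v \<bullet> \<nabla> H (x\<^sub>1 - m x\<^sub>2) = 0\<close>. A bounded Borel function is almost
everywhere a limit of uniformly bounded polynomials on a compact interval, and dominated convergence
carries the identity over (\<open>green_square_constant_along_lines\<close>). Integrating over \<open>v\<close> and \<open>t\<close>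
gives the weak equation (\<open>weak_free_transport_line_profile\<close>).\<close>

section \<open>Gaussian integrals and the Bessel function\<close>

lemma has_integral_cos_power_rec:
  assumes "((\<lambda>\<phi>. cos \<phi> ^ n) has_integral w) {0..pi}"
  shows "((\<lambda>\<phi>. cos \<phi> ^ (n + 2)) has_integral (real n + 1) / (real n + 2) * w) {0..pi}"
proof -
  have "((\<lambda>\<phi>. (real n + 2) * cos \<phi> ^ (n + 2) - (real n + 1) * cos \<phi> ^ n)
      has_integral (sin pi * cos pi ^ (n + 1) - sin 0 * cos 0 ^ (n + 1))) {0..pi}"
  proof (rule fundamental_theorem_of_calculus)
    fix \<phi> :: real
    have s: "sin \<phi> * sin \<phi> = 1 - cos \<phi> * cos \<phi>"
      using sin_cos_squared_add[of \<phi>] by (simp add: power2_eq_square)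
    have "((\<lambda>\<phi>. sin \<phi> * cos \<phi> ^ (n + 1)) has_real_derivative
        cos \<phi> * cos \<phi> ^ (n + 1) + sin \<phi> * (real (n + 1) * (- sin \<phi>) * cos \<phi> ^ n)) (at \<phi>)"
      by (rule derivative_eq_intros refl | simp add: algebra_simps)+
    also have "cos \<phi> * cos \<phi> ^ (n + 1) + sin \<phi> * (real (n + 1) * (- sin \<phi>) * cos \<phi> ^ n)
      = cos \<phi> ^ (n + 2) - (real n + 1) * cos \<phi> ^ n * (sin \<phi> * sin \<phi>)"
      by (simp add: algebra_simps)
    also have "\<dots> = (real n + 2) * cos \<phi> ^ (n + 2) - (real n + 1) * cos \<phi> ^ n"
      unfolding s by (simp add: algebra_simps)
    finally show "((\<lambda>\<phi>. sin \<phi> * cos \<phi> ^ (n + 1)) has_vector_derivative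
        (real n + 2) * cos \<phi> ^ (n + 2) - (real n + 1) * cos \<phi> ^ n) (at \<phi> within {0..pi})"
      by (simp add: has_real_derivative_iff_has_vector_derivative[symmetric] has_field_derivative_at_within)
  qed simp
  from has_integral_add[OF this has_integral_mult_right[OF assms, of "real n + 1"]]
  have "((\<lambda>\<phi>. (real n + 2) * cos \<phi> ^ (n + 2)) has_integral (real n + 1) * w) {0..pi}"
    by simp
  from has_integral_mult_right[OF this, of "inverse (real n + 2)"]
  have "((\<lambda>\<phi>. inverse (real n + 2) * (real n + 2) * cos \<phi> ^ (n + 2)) has_integral
      inverse (real n + 2) * ((real n + 1) * w)) {0..pi}"
    by (simp only: mult.assoc)
  moreover have "inverse (real n + 2) * (real n + 2) = 1"
    by (rule left_inverse) simp
  moreover have "inverse (real n + 2) * ((real n + 1) * w) = (real n + 1) / (real n + 2) * w"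
    by (simp add: divide_inverse mult_ac)
  ultimately show ?thesis
    by (simp only: mult_1)
qed

lemma has_integral_cos_power_even:
  "((\<lambda>\<phi>. cos \<phi> ^ (2 * k)) has_integral pi * fact (2 * k) / (4 ^ k * (fact k)\<^sup>2)) {0..pi}"
proof (induction k)
  case 0
  show ?case using has_integral_const_real[of "1::real" 0 pi] by simp
next
  case (Suc k)
  have "(real (2 * k) + 1) / (real (2 * k) + 2) * (pi * fact (2 * k) / (4 ^ k * (fact k)\<^sup>2))
      = pi * fact (2 * Suc k) / (4 ^ Suc k * (fact (Suc k))\<^sup>2)"
  proof -
    have f: "fact (2 * Suc k) = 2 * (real k + 1) * (2 * real k + 1) * fact (2 * k)"
      "fact (Suc k) = (real k + 1) * fact k"
      by (simp_all add: algebra_simps)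
    have "real k + 1 \<noteq> 0" by simp
    then show ?thesis
      unfolding f power2_eq_square power_Suc by (simp add: divide_simps) (simp add: algebra_simps)
  qed
  then show ?case
    using has_integral_cos_power_rec[OF Suc] by simp
qed

lemma has_integral_cos_power_odd: "((\<lambda>\<phi>. cos \<phi> ^ (2 * k + 1)) has_integral 0) {0..pi}"
proof (induction k)
  case 0
  have "((\<lambda>\<phi>. cos \<phi>) has_integral (sin pi - sin 0)) {0..pi}"
    by (rule fundamental_theorem_of_calculus)
      (auto intro!: derivative_eq_intros simp: has_real_derivative_iff_has_vector_derivative[symmetric])
  then show ?case by simp
next
  case (Suc k)
  show ?case using has_integral_cos_power_rec[OF Suc] by simp
qed

text \<open>The exponential series of \<open>exp (y * cos \<phi>)\<close> converges uniformly in \<open>\<phi>\<close>; the odd powers of the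
cosine integrate to 0 and the even ones give the central binomial coefficients.\<close>

lemma bessel_I0_sums: "(\<lambda>k. (y\<^sup>2 / 4) ^ k / (fact k)\<^sup>2) sums bessel_I0 y"
proof -
  define f where "f n \<phi> = (\<Sum>k<n. (y * cos \<phi>) ^ k / fact k)" for n :: nat and \<phi> :: real
  define w where "w k = (if even k then pi * fact k / (4 ^ (k div 2) * (fact (k div 2))\<^sup>2) else 0)" for k :: nat
  have w: "((\<lambda>\<phi>. cos \<phi> ^ k) has_integral w k) {0..pi}" for k
  proof (cases "even k")
    case True
    then obtain j where "k = 2 * j" by (elim evenE)
    then show ?thesis using has_integral_cos_power_even[of j] by (simp add: w_def)
  next
    case False
    then obtain j where "k = 2 * j + 1" by (elim oddE)
    then show ?thesis using has_integral_cos_power_odd[of j] by (simp add: w_def)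
  qed
  have unif: "uniform_limit {0..pi} f (\<lambda>\<phi>. exp (y * cos \<phi>)) sequentially"
  proof -
    have "uniform_limit {0..pi} (\<lambda>n \<phi>. \<Sum>k<n. (y * cos \<phi>) ^ k / fact k)
        (\<lambda>\<phi>. suminf (\<lambda>k. (y * cos \<phi>) ^ k / fact k)) sequentially"
    proof (rule Weierstrass_m_test)
      fix n \<phi>
      have "\<bar>y * cos \<phi>\<bar> ^ n \<le> \<bar>y\<bar> ^ n"
        by (intro power_mono) (auto simp: abs_mult intro: mult_left_le)
      then show "norm ((y * cos \<phi>) ^ n / fact n) \<le> \<bar>y\<bar> ^ n / fact n"
        by (simp add: power_abs divide_right_mono)
    next
      show "summable (\<lambda>n. \<bar>y\<bar> ^ n / fact n)"
        using summable_exp_generic[of "\<bar>y\<bar>"] by (simp add: field_simps)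
    qed
    then show ?thesis unfolding f_def exp_def by (simp add: field_simps)
  qed
  have fint: "(f n has_integral (\<Sum>k<n. y ^ k / fact k * w k)) {0..pi}" for n
    unfolding f_def
  proof (rule has_integral_sum)
    fix k
    from has_integral_mult_right[OF w, of "y ^ k / fact k" k]
    show "((\<lambda>\<phi>. (y * cos \<phi>) ^ k / fact k) has_integral y ^ k / fact k * w k) {0..pi}"
      by (simp add: power_mult_distrib)
  qed simp
  obtain I J where I: "\<And>n. (f n has_integral I n) {0..pi}"
    and J: "((\<lambda>\<phi>. exp (y * cos \<phi>)) has_integral J) {0..pi}" and lim: "I \<longlonglongrightarrow> J"
    by (rule uniform_limit_integral[where a = 0 and b = pi and f = f and g = "\<lambda>\<phi>. exp (y * cos \<phi>)" and F = sequentially])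
      (use unif in \<open>auto simp: f_def intro!: continuous_intros\<close>)
  have "I = (\<lambda>n. \<Sum>k<n. y ^ k / fact k * w k)"
    using has_integral_unique[OF I fint] by (rule ext)
  then have "(\<lambda>k. y ^ k / fact k * w k) sums J"
    using lim unfolding sums_def by (simp only:)
  then have "(\<lambda>k. y ^ (2 * k) / fact (2 * k) * w (2 * k)) sums J"
    by (subst sums_mono_reindex[where g = "\<lambda>k. 2 * k"])
      (auto simp: strict_mono_def w_def elim!: evenE)
  from sums_mult[OF this, of "1 / pi"] have "(\<lambda>k. (y\<^sup>2 / 4) ^ k / (fact k)\<^sup>2) sums (1 / pi * J)"
    by (simp add: w_def power_mult power_divide)
  moreover have "J = integral {0..pi} (\<lambda>\<phi>. exp (y * cos \<phi>))"
    using J by (simp add: integral_unique)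
  ultimately show ?thesis by (simp add: bessel_I0_def)
qed

lemma has_bochner_integral_halfline_scale:
  fixes g :: "real \<Rightarrow> real"
  assumes "has_bochner_integral lborel (\<lambda>x. indicator {0..} x *\<^sub>R g x) I" "0 < c"
  shows "has_bochner_integral lborel (\<lambda>x. indicator {0..} x *\<^sub>R g (c * x)) (I / c)"
proof -
  have "has_bochner_integral lborel (\<lambda>x. indicator {0..} (0 + c * x) *\<^sub>R g (0 + c * x)) (I /\<^sub>R \<bar>c\<bar>)"
    using assms by (subst lborel_has_bochner_integral_real_affine_iff[symmetric]) auto
  moreover have "indicator {0..} (c * x) = (indicator {0..} x :: real)" for x
    using assms(2) by (auto simp: indicator_def zero_le_mult_iff)
  ultimately show ?thesis using assms(2) by (simp add: divide_inverse mult.commute)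
qed

lemma halfline_gaussian_moment_odd:
  assumes A: "0 < A"
  shows "has_bochner_integral lborel
    (\<lambda>s::real. indicator {0..} s *\<^sub>R (exp (- (A * s\<^sup>2 / 2)) * s ^ (2 * k + 1))) (2 ^ k * fact k / A ^ (k + 1))"
proof -
  define c where "c = sqrt (A / 2)"
  have c: "0 < c" "c\<^sup>2 = A / 2" using A by (auto simp: c_def)
  have ck: "c ^ (2 * k + 1) * c = (A / 2) ^ (k + 1)"
  proof -
    have "c ^ (2 * k + 1) * c = c ^ (2 * (k + 1))" by simp
    also have "\<dots> = (A / 2) ^ (k + 1)" unfolding power_mult c(2) ..
    finally show ?thesis .
  qed
  have "has_bochner_integral lborel (\<lambda>s. inverse (c ^ (2 * k + 1)) *
      (indicator {0..} s *\<^sub>R (exp (- (c * s)\<^sup>2) * (c * s) ^ (2 * k + 1))))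
      (inverse (c ^ (2 * k + 1)) * (fact k / 2 / c))"
    by (intro has_bochner_integral_mult_right has_bochner_integral_halfline_scale
      gaussian_moment_odd_pos c)
  moreover have "inverse (c ^ (2 * k + 1)) * (fact k / 2 / c) = 2 ^ k * fact k / A ^ (k + 1)"
  proof -
    have "inverse (c ^ (2 * k + 1)) * (fact k / 2 / c) = fact k / 2 / (c ^ (2 * k + 1) * c)"
      by (simp add: field_simps)
    also have "\<dots> = 2 ^ k * fact k / A ^ (k + 1)"
      unfolding ck using A by (simp add: field_simps power_divide)
    finally show ?thesis .
  qed
  moreover have "inverse (c ^ (2 * k + 1)) * (indicator {0..} s *\<^sub>R (exp (- (c * s)\<^sup>2) * (c * s) ^ (2 * k + 1)))
      = indicator {0..} s *\<^sub>R (exp (- (A * s\<^sup>2 / 2)) * s ^ (2 * k + 1))" for s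
    using c(1) unfolding power_mult_distrib c(2) by (simp add: field_simps)
  ultimately show ?thesis
    by (simp only:)
qed

lemma halfline_gaussian_moment_two:
  assumes A: "0 < A"
  shows "has_bochner_integral lborel
    (\<lambda>s::real. indicator {0..} s *\<^sub>R (exp (- (A * s\<^sup>2 / 2)) * s\<^sup>2)) (sqrt (pi / 2) / (A * sqrt A))"
proof -
  define c where "c = sqrt (A / 2)"
  have c: "0 < c" "c\<^sup>2 = A / 2" using A by (auto simp: c_def)
  have g: "has_bochner_integral lborel (\<lambda>x::real. indicator {0..} x *\<^sub>R (exp (-x\<^sup>2)*x\<^sup>2)) (sqrt pi / 4)"
    using gaussian_moment_even_pos[of 1] by (simp add: fact_numeral)
  have "has_bochner_integral lborel (\<lambda>s. inverse (c\<^sup>2) *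
      (indicator {0..} s *\<^sub>R (exp (- (c * s)\<^sup>2) * (c * s)\<^sup>2)))
      (inverse (c\<^sup>2) * (sqrt pi / 4 / c))"
    by (intro has_bochner_integral_mult_right has_bochner_integral_halfline_scale g c)
  moreover have "inverse (c\<^sup>2) * (sqrt pi / 4 / c) = sqrt (pi / 2) / (A * sqrt A)"
    unfolding c(2) using A by (simp add: c_def real_sqrt_divide field_simps)
  ultimately show ?thesis
    using c A by (simp add: power_mult_distrib mult_ac)
qed

text \<open>Only even powers occur in the series of \<open>bessel_I0\<close>, so its terms are nonnegative and may be
integrated one by one against the weight; the odd Gaussian moments cancel one of the two factorials
and leave an exponential series.\<close>

lemma rayleigh_bessel_integral:
  assumes A: "0 < A"
  shows "has_bochner_integral lborel
    (\<lambda>s. indicator {0..} s *\<^sub>R (s * exp (- (A * s\<^sup>2 / 2)) * bessel_I0 (b * s))) (exp (b\<^sup>2 / (2 * A)) / A)"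
proof -
  define f where "f k s = ((b\<^sup>2 / 4) ^ k / (fact k)\<^sup>2) *
    (indicator {0..} s *\<^sub>R (exp (- (A * s\<^sup>2 / 2)) * s ^ (2 * k + 1)))" for k s
  have f: "has_bochner_integral lborel (f k) ((b\<^sup>2 / (2 * A)) ^ k / fact k / A)" for k
  proof -
    have "has_bochner_integral lborel (f k) ((b\<^sup>2 / 4) ^ k / (fact k)\<^sup>2 * (2 ^ k * fact k / A ^ (k + 1)))"
      unfolding f_def by (intro has_bochner_integral_mult_right halfline_gaussian_moment_odd A)
    moreover have "(b\<^sup>2 / 4) ^ k / (fact k)\<^sup>2 * (2 ^ k * fact k / A ^ (k + 1))
        = (b\<^sup>2 / 4 * 2 / A) ^ k / fact k / A"
      unfolding power_divide power_mult_distrib by (simp add: power2_eq_square)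
    moreover have "b\<^sup>2 / 4 * 2 / A = b\<^sup>2 / (2 * A)"
      by simp
    ultimately show ?thesis by simp
  qed
  have nn: "0 \<le> f k s" for k s
    by (auto simp: f_def indicator_def)
  have e: "(\<lambda>k. (b\<^sup>2 / (2 * A)) ^ k / fact k / A) sums (exp (b\<^sup>2 / (2 * A)) / A)"
    using sums_divide[OF exp_converges[of "b\<^sup>2 / (2 * A)"], of A] by (simp add: field_simps)
  have fs: "(\<lambda>k. f k s) sums (indicator {0..} s *\<^sub>R (s * exp (- (A * s\<^sup>2 / 2)) * bessel_I0 (b * s)))" for s
  proof -
    have "(\<lambda>k. indicator {0..} s * (s * exp (- (A * s\<^sup>2 / 2))) * (((b * s)\<^sup>2 / 4) ^ k / (fact k)\<^sup>2))
        sums (indicator {0..} s * (s * exp (- (A * s\<^sup>2 / 2))) * bessel_I0 (b * s))"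
      by (intro sums_mult bessel_I0_sums)
    moreover have "indicator {0..} s * (s * exp (- (A * s\<^sup>2 / 2))) * (((b * s)\<^sup>2 / 4) ^ k / (fact k)\<^sup>2) = f k s" for k
    proof -
      have "(b * s)\<^sup>2 / 4 = b\<^sup>2 / 4 * s\<^sup>2" by (simp add: power_mult_distrib)
      then have "((b * s)\<^sup>2 / 4) ^ k = (b\<^sup>2 / 4) ^ k * s ^ (2 * k)"
        by (simp only: power_mult_distrib power_mult)
      then show ?thesis by (simp add: f_def)
    qed
    ultimately show ?thesis
      by (simp add: mult.assoc)
  qed
  have 1: "integrable lborel (f k)" for k using f by (rule integrable.intros)
  have 2: "AE s in lborel. summable (\<lambda>k. norm (f k s))"
    using fs nn by (simp add: sums_iff)
  have 3: "summable (\<lambda>k. \<integral>s. norm (f k s) \<partial>lborel)"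
    using f e nn by (simp add: has_bochner_integral_iff sums_iff)
  have "(\<lambda>s. \<Sum>k. f k s) = (\<lambda>s. indicator {0..} s *\<^sub>R (s * exp (- (A * s\<^sup>2 / 2)) * bessel_I0 (b * s)))"
    using fs by (auto simp: sums_iff)
  moreover have "(\<Sum>k. integral\<^sup>L lborel (f k)) = exp (b\<^sup>2 / (2 * A)) / A"
    using f e by (simp add: has_bochner_integral_iff sums_iff)
  ultimately show ?thesis
    using integrable_suminf[OF 1 2 3] integral_suminf[OF 1 2 3] by (simp add: has_bochner_integral_iff)
qed

text \<open>Completing the square identifies the integrand with a multiple of a normal density.\<close>

lemma gaussian_shift_integral:
  assumes A: "0 < A"
  shows "has_bochner_integral lborel (\<lambda>s. exp (- (A * s\<^sup>2 / 2) + B * s)) (sqrt (2 * pi / A) * exp (B\<^sup>2 / (2 * A)))"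
proof -
  have n: "has_bochner_integral lborel (normal_density (B / A) (1 / sqrt A)) 1"
    using A by (auto simp: has_bochner_integral_iff)
  have "exp (- (A * s\<^sup>2 / 2) + B * s)
      = sqrt (2 * pi / A) * exp (B\<^sup>2 / (2 * A)) * normal_density (B / A) (1 / sqrt A) s" for s
  proof -
    have "- (A * s\<^sup>2 / 2) + B * s = B\<^sup>2 / (2 * A) + - (s - B / A)\<^sup>2 / (2 * (1 / sqrt A)\<^sup>2)"
      using A by (simp add: power_divide field_simps power2_eq_square)
    then show ?thesis
      using A by (simp add: normal_density_def exp_add[symmetric] power_divide)
  qed
  then show ?thesis
    using has_bochner_integral_mult_right[OF n, of "sqrt (2 * pi / A) * exp (B\<^sup>2 / (2 * A))"] by simp
qed

lemma has_bochner_integral_prod_mult: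
  fixes f :: "'a::euclidean_space \<Rightarrow> real" and g :: "'b::euclidean_space \<Rightarrow> real"
  assumes f: "has_bochner_integral lborel f I" and g: "has_bochner_integral lborel g J"
  shows "has_bochner_integral lborel (\<lambda>u. f (fst u) * g (snd u)) (I * J)"
proof -
  have [measurable]: "f \<in> borel_measurable borel" "g \<in> borel_measurable borel"
    and fi: "integrable lborel f" "integrable lborel g"
    and fg: "integral\<^sup>L lborel f = I" "integral\<^sup>L lborel g = J"
    using f g by (auto simp: has_bochner_integral_iff dest: borel_measurable_integrable)
  have i: "integrable (lborel \<Otimes>\<^sub>M lborel) (\<lambda>u. f (fst u) * g (snd u))"
    by (rule lborel_pair.Fubini_integrable) (use fi in \<open>auto simp: abs_mult\<close>)
  from lborel_pair.integral_fst'[OF i] have "integral\<^sup>L (lborel \<Otimes>\<^sub>M lborel) (\<lambda>u. f (fst u) * g (snd u)) = I * J"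
    by (simp add: fg)
  with i show ?thesis by (simp add: has_bochner_integral_iff lborel_prod)
qed

section \<open>Reflection of a Maxwellian by the Cercignani-Lampis kernel\<close>

text \<open>The Maxwellian of temperature \<open>S\<close> normalised so that the flux through the line \<open>v\<^sub>2 = 0\<close>, not the
mass, is 1.\<close>

definition wall_maxwellian :: "real \<Rightarrow> plane \<Rightarrow> real" where
  "wall_maxwellian S v = exp (- ((norm v)\<^sup>2 / (2 * S))) / (S * sqrt (2 * pi * S))"

lemma norm_plane_sq: "(norm (v :: plane))\<^sup>2 = (fst v)\<^sup>2 + (snd v)\<^sup>2"
  by (simp add: norm_prod_def)

text \<open>The kernel times the incoming Maxwellian is a product of a function of \<open>u\<^sub>1\<close> and a function of
\<open>u\<^sub>2\<close>. In both factors the quadratic part is the same, with coefficient \<open>A = S / (T * r)\<close>: for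
\<open>u\<^sub>2\<close> because \<open>1 + (1 - r) / (T * r) = A\<close>, and for \<open>u\<^sub>1\<close> because \<open>(1 - p)\<^sup>2 = 1 - r\<close>. The tangential
factor is a shifted Gaussian and the normal factor is the Rayleigh-Bessel integral.\<close>

lemma CL_reflects_maxwellian:
  assumes T: "0 < T" and r: "0 < r" "r < 1" and p: "p * (2 - p) = r" and v: "0 < snd v"
  shows "(LINT u:{u. snd u < 0}|lborel.
      (- snd u) * CL_kernel r p T u v * (exp (- ((norm u)\<^sup>2 / 2)) / sqrt (2 * pi)))
    = wall_maxwellian (1 - r + r * T) v"
proof -
  define S where "S = 1 - r + r * T"
  have S: "0 < S" using r T by (simp add: S_def add_pos_pos)
  define A where "A = S / (T * r)"
  have A: "0 < A" using S T r by (simp add: A_def)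
  define B where "B = (1 - p) * fst v / (T * r)"
  define b where "b = - (sqrt (1 - r) * snd v / (T * r))"
  define C where "C = 1 / (T * r * sqrt (2 * pi * (T * r))) * exp (- ((snd v)\<^sup>2 / (2 * (T * r))))
    * exp (- ((fst v)\<^sup>2 / (2 * (T * r)))) / sqrt (2 * pi)"
  have p2: "(1 - p)\<^sup>2 = 1 - r" using p by (simp add: power2_eq_square algebra_simps)
  have F: "has_bochner_integral lborel (\<lambda>s. exp (- (A * s\<^sup>2 / 2) + B * s))
      (sqrt (2 * pi / A) * exp (B\<^sup>2 / (2 * A)))"
    by (rule gaussian_shift_integral[OF A])
  have G: "has_bochner_integral lborel
      (\<lambda>s. indicator {0..} (- s) *\<^sub>R (- s * exp (- (A * (- s)\<^sup>2 / 2)) * bessel_I0 (b * - s)))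
      (exp (b\<^sup>2 / (2 * A)) / A)"
    using rayleigh_bessel_integral[OF A, of b]
      lborel_has_bochner_integral_real_affine_iff[of "-1"
        "\<lambda>s. indicator {0..} s *\<^sub>R (s * exp (- (A * s\<^sup>2 / 2)) * bessel_I0 (b * s))" _ 0]
    by simp
  have I: "has_bochner_integral lborel
      (\<lambda>u. C * (exp (- (A * (fst u)\<^sup>2 / 2) + B * fst u) *
        (indicator {0..} (- snd u) *\<^sub>R (- snd u * exp (- (A * (- snd u)\<^sup>2 / 2)) * bessel_I0 (b * - snd u)))))
      (C * (sqrt (2 * pi / A) * exp (B\<^sup>2 / (2 * A)) * (exp (b\<^sup>2 / (2 * A)) / A)))"
    by (intro has_bochner_integral_mult_right has_bochner_integral_prod_mult F G)
  have eq: "indicator {u. snd u < 0} u *\<^sub>R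
      ((- snd u) * CL_kernel r p T u v * (exp (- ((norm u)\<^sup>2 / 2)) / sqrt (2 * pi)))
    = C * (exp (- (A * (fst u)\<^sup>2 / 2) + B * fst u) *
        (indicator {0..} (- snd u) *\<^sub>R (- snd u * exp (- (A * (- snd u)\<^sup>2 / 2)) * bessel_I0 (b * - snd u))))"
    (is "?L = ?R") for u
  proof (cases "snd u < 0")
    case False
    then show ?thesis by (cases "snd u = 0") auto
  next
    case True
    have c: "2 * T * p * (2 - p) = 2 * (T * r)" "2 * pi * T * p * (2 - p) = 2 * pi * (T * r)" "2 * T * r = 2 * (T * r)"
      using p by (simp_all add: mult.assoc)
    have i: "sqrt (1 - r) * snd v * snd u / (T * r) = b * - snd u"
      by (simp add: b_def)
    have e: "- (((snd v)\<^sup>2 + (1 - r) * (snd u)\<^sup>2) / (2 * (T * r)))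
        + (- ((fst v - (1 - p) * fst u)\<^sup>2 / (2 * (T * r)))) + (- ((norm u)\<^sup>2 / 2))
      = - ((snd v)\<^sup>2 / (2 * (T * r))) + (- ((fst v)\<^sup>2 / (2 * (T * r))))
        + (- (A * (fst u)\<^sup>2 / 2) + B * fst u) + (- (A * (- snd u)\<^sup>2 / 2))"
    proof -
      have q: "(fst v - (1 - p) * fst u)\<^sup>2 = (fst v)\<^sup>2 - 2 * ((1 - p) * fst v * fst u) + (1 - r) * (fst u)\<^sup>2"
        unfolding p2[symmetric] by (simp add: power2_eq_square algebra_simps)
      show ?thesis
        unfolding q norm_plane_sq A_def B_def S_def using T r
        by (simp add: divide_simps) (simp add: algebra_simps power2_eq_square)
    qed
    have "?L = - snd u / (T * r * sqrt (2 * pi * (T * r))) / sqrt (2 * pi) * bessel_I0 (b * - snd u)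
        * (exp (- (((snd v)\<^sup>2 + (1 - r) * (snd u)\<^sup>2) / (2 * (T * r))))
          * exp (- ((fst v - (1 - p) * fst u)\<^sup>2 / (2 * (T * r)))) * exp (- ((norm u)\<^sup>2 / 2)))"
      using True unfolding CL_kernel_def c i by simp
    also have "\<dots> = ?R"
      unfolding exp_add[symmetric] e using True unfolding exp_add C_def by simp
    finally show ?thesis .
  qed
  have "C * (sqrt (2 * pi / A) * exp (B\<^sup>2 / (2 * A)) * (exp (b\<^sup>2 / (2 * A)) / A)) = wall_maxwellian S v"
  proof -
    have k: "1 / (T * r) / A = 1 / S" using T r by (simp add: A_def)
    have s: "sqrt (2 * pi / A) / (sqrt (2 * pi * (T * r)) * sqrt (2 * pi)) = 1 / sqrt (2 * pi * S)"
    proof -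
      have "2 * pi / A = (2 * pi * (T * r)) * (2 * pi) / (2 * pi * S)" by (simp add: A_def)
      then show ?thesis using T r S by (simp add: real_sqrt_mult real_sqrt_divide)
    qed
    have b2: "b\<^sup>2 = (1 - r) * (snd v)\<^sup>2 / (T * r)\<^sup>2"
      using r by (simp add: b_def power_divide power_mult_distrib)
    have B2: "B\<^sup>2 = (1 - r) * (fst v)\<^sup>2 / (T * r)\<^sup>2"
      by (simp add: B_def power_divide power_mult_distrib p2)
    \<comment> \<open>In both components the exponent left by completing the square combines with that of the kernel to the exponent of temperature \<open>S\<close>.\<close>
    have e1: "- (x / (2 * (T * r))) + (1 - r) * x / (T * r)\<^sup>2 / (2 * A) = - (x / (2 * S))" for x
    proof -
      have "(1 - r) * x / (T * r)\<^sup>2 / (2 * A) = (1 - r) * x / (2 * (T * r) * S)"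
        using T r by (simp add: A_def power2_eq_square)
      also have "- (x / (2 * (T * r))) + \<dots> = - (x / (2 * S)) * ((S - (1 - r)) / (T * r))"
        using T r S by (simp add: divide_simps) (simp add: algebra_simps)
      also have "(S - (1 - r)) / (T * r) = 1" using T r by (simp add: S_def)
      finally show ?thesis by simp
    qed
    have "C * (sqrt (2 * pi / A) * exp (B\<^sup>2 / (2 * A)) * (exp (b\<^sup>2 / (2 * A)) / A))
        = (1 / (T * r) / A) * (sqrt (2 * pi / A) / (sqrt (2 * pi * (T * r)) * sqrt (2 * pi)))
          * exp (- ((fst v)\<^sup>2 / (2 * (T * r))) + B\<^sup>2 / (2 * A))
          * exp (- ((snd v)\<^sup>2 / (2 * (T * r))) + b\<^sup>2 / (2 * A))"
      unfolding C_def exp_add by (simp add: mult_ac)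
    also have "\<dots> = exp (- ((fst v)\<^sup>2 / (2 * S)) + - ((snd v)\<^sup>2 / (2 * S))) / (S * sqrt (2 * pi * S))"
      unfolding k s b2 B2 e1 exp_add by simp
    also have "\<dots> = wall_maxwellian S v"
      by (simp add: wall_maxwellian_def norm_plane_sq add_divide_distrib)
    finally show ?thesis .
  qed
  then show ?thesis
    using I unfolding set_lebesgue_integral_def eq S_def by (simp add: has_bochner_integral_iff)
qed

lemma wall_maxwellian_nonneg: "0 < S \<Longrightarrow> 0 \<le> wall_maxwellian S v"
  by (simp add: wall_maxwellian_def)

lemma wall_maxwellian_pos: "0 < S \<Longrightarrow> 0 < wall_maxwellian S v"
  by (simp add: wall_maxwellian_def)

text \<open>One Gaussian dominates all temperatures in \<open>[c, 1]\<close>; every integrability claim below rests on this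
bound.\<close>

lemma wall_maxwellian_le:
  assumes "0 < c" "c \<le> S" "S \<le> 1"
  shows "wall_maxwellian S v \<le> exp (- ((norm v)\<^sup>2 / 2)) / (c * sqrt (2 * pi * c))"
  unfolding wall_maxwellian_def
proof (rule frac_le)
  have "(norm v)\<^sup>2 / 2 \<le> (norm v)\<^sup>2 / (2 * S)"
    using assms by (intro divide_left_mono) auto
  then show "exp (- ((norm v)\<^sup>2 / (2 * S))) \<le> exp (- ((norm v)\<^sup>2 / 2))" by simp
  show "c * sqrt (2 * pi * c) \<le> S * sqrt (2 * pi * S)"
    using assms by (intro mult_mono) auto
qed (use assms in auto)

lemma measurable_wall_maxwellian [measurable]:
  assumes [measurable]: "f \<in> borel_measurable M" "g \<in> borel_measurable M"
  shows "(\<lambda>x. wall_maxwellian (f x) (g x)) \<in> borel_measurable M"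
  unfolding wall_maxwellian_def by measurable

lemma integrable_gaussian_linear:
  "integrable lborel (\<lambda>v::plane. (1 + norm v) * exp (- ((norm v)\<^sup>2 / 2)))"
proof (rule Bochner_Integration.integrable_bound)
  have "has_bochner_integral lborel (\<lambda>s::real. exp (- (s\<^sup>2 / 4))) (sqrt (4 * pi))"
    using gaussian_shift_integral[of "1 / 2" 0] by simp
  from has_bochner_integral_prod_mult[OF this this]
  have "integrable lborel (\<lambda>v::plane. exp (- ((fst v)\<^sup>2 / 4)) * exp (- ((snd v)\<^sup>2 / 4)))"
    by (rule integrable.intros)
  then show "integrable lborel (\<lambda>v::plane. 2 * exp (- ((norm v)\<^sup>2 / 4)))"
    by (simp add: norm_plane_sq exp_add[symmetric] add_divide_distrib)
  show "AE v in lborel. norm ((1 + norm v) * exp (- ((norm v)\<^sup>2 / 2)))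
      \<le> norm (2 * exp (- ((norm (v::plane))\<^sup>2 / 4)))"
  proof (rule AE_I2)
    fix v :: plane
    define x where "x = norm v"
    have "1 + x \<le> 2 * (1 + x\<^sup>2 / 4)"
      using zero_le_power2[of "x - 1"] by (simp add: power2_eq_square algebra_simps)
    also have "\<dots> \<le> 2 * exp (x\<^sup>2 / 4)"
      by (intro mult_left_mono exp_ge_add_one_self) auto
    finally have "(1 + x) * exp (- (x\<^sup>2 / 2)) \<le> 2 * exp (x\<^sup>2 / 4) * exp (- (x\<^sup>2 / 2))"
      by (intro mult_right_mono) auto
    also have "\<dots> = 2 * exp (- (x\<^sup>2 / 4))"
      by (simp add: exp_add[symmetric])
    finally show "norm ((1 + norm v) * exp (- ((norm v)\<^sup>2 / 2))) \<le> norm (2 * exp (- ((norm v)\<^sup>2 / 4)))"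
      by (simp add: x_def)
  qed
qed simp

lemma half_planes_borel [measurable]:
  "{v :: plane. 0 < snd v} \<in> sets borel" "{v :: plane. snd v < 0} \<in> sets borel"
  by (auto intro!: borel_open open_Collect_less continuous_intros)

section \<open>Velocity moments along rays\<close>

text \<open>Integration over the upper half plane in the coordinates slope and height: for fixed height \<open>s\<close> the
substitution \<open>v\<^sub>1 = m * s\<close> is linear with factor \<open>s\<close>, so that no two-dimensional change of variables
is needed.\<close>

lemma integral_plane_slope:
  fixes G :: "plane \<Rightarrow> real"
  assumes G: "integrable lborel G"
  shows "(LINT v:{v. 0 < snd v}|lborel. G v)
    = (LINT m|lborel. LINT s|lborel. indicator {0<..} s * (s * G (m * s, s)))"
proof -
  have [measurable]: "G \<in> borel_measurable borel" using G by (auto dest: borel_measurable_integrable)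
  define F where "F s y = indicator {0<..} s * G (y, s)" for s y
  have [measurable]: "(\<lambda>(s, y). F s y) \<in> borel_measurable (lborel \<Otimes>\<^sub>M lborel)"
    unfolding F_def by measurable
  have GF: "integrable (lborel \<Otimes>\<^sub>M lborel) (\<lambda>(y, s). F s y)"
  proof -
    have "integrable lborel (\<lambda>v. indicator {v. 0 < snd v} v *\<^sub>R G v)"
      by (intro integrable_mult_indicator G) (simp add: half_planes_borel)
    then show ?thesis
      by (simp add: lborel_prod F_def indicator_def case_prod_unfold)
  qed
  have Fi: "integrable (lborel \<Otimes>\<^sub>M lborel) (\<lambda>(s, y). F s y)"
    using lborel_pair.integrable_product_swap[OF GF] by (simp add: split_beta)
  have aff: "(LINT m|lborel. \<bar>s\<bar> * g (m * s)) = integral\<^sup>L lborel g" if "s \<noteq> 0" for s and g :: "real \<Rightarrow> real"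
    using lborel_integral_real_affine[of s g 0] that by (simp add: mult.commute)
  have Ki: "integrable (lborel \<Otimes>\<^sub>M lborel) (\<lambda>(s, m). s * F s (m * s))"
  proof (rule lborel_pair.Fubini_integrable)
    have "(LINT m|lborel. norm (s * F s (m * s))) = (LINT y|lborel. norm (F s y))" for s
      using aff[of s "\<lambda>y. norm (F s y)"] by (cases "s = 0") (auto simp: F_def abs_mult)
    moreover have "integrable lborel (\<lambda>s. LINT y|lborel. norm (F s y))"
      using lborel_pair.integrable_fst'[OF integrable_norm[OF Fi]] by simp
    ultimately show "integrable lborel (\<lambda>s. LINT m|lborel. norm (case (s, m) of (s, m) \<Rightarrow> s * F s (m * s)))"
      by simp
    show "AE s in lborel. integrable lborel (\<lambda>m. case (s, m) of (s, m) \<Rightarrow> s * F s (m * s))"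
      using lborel_pair.AE_integrable_fst'[OF Fi]
    proof eventually_elim
      case (elim s)
      then show ?case
        using lborel_integrable_real_affine[of "F s" s 0] by (cases "s = 0") (auto simp: mult.commute)
    qed
  qed (simp add: F_def split_beta)
  have "(LINT v:{v. 0 < snd v}|lborel. G v) = integral\<^sup>L (lborel \<Otimes>\<^sub>M lborel) (\<lambda>(y, s). F s y)"
    unfolding set_lebesgue_integral_def
    by (subst lborel_prod) (auto simp: F_def indicator_def split_beta intro!: Bochner_Integration.integral_cong)
  also have "\<dots> = (LINT s|lborel. LINT y|lborel. F s y)"
    using lborel_pair.integral_snd[OF GF] by simp
  also have "\<dots> = (LINT s|lborel. LINT m|lborel. s * F s (m * s))"
  proof (rule Bochner_Integration.integral_cong[OF refl])
    fix s
    have "F s = (\<lambda>y. indicator {0<..} s * G (y, s))" by (simp add: F_def fun_eq_iff)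
    then show "(LINT y|lborel. F s y) = (LINT m|lborel. s * F s (m * s))"
      using aff[of s "F s"] by (cases "s > 0") auto
  qed
  also have "\<dots> = (LINT m|lborel. LINT s|lborel. s * F s (m * s))"
    using lborel_pair.Fubini_integral[OF Ki] by simp
  finally show ?thesis by (simp add: F_def mult_ac)
qed

lemma integral_plane_uminus:
  fixes G :: "plane \<Rightarrow> real"
  assumes [measurable]: "G \<in> borel_measurable borel"
  shows "(LINT v|lborel. G (- v)) = (LINT v|lborel. G v)"
proof -
  have "(lborel :: plane measure) = distr lborel borel (\<lambda>x. - x)"
    using lborel_affine[of "- 1" "0 :: plane"] by (simp add: density_1)
  then have "(LINT v|lborel. G v) = (LINT v|distr lborel borel (\<lambda>x. - x). G v)"
    by simp
  also have "\<dots> = (LINT v|lborel. G (- v))"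
    by (rule integral_distr) auto
  finally show ?thesis ..
qed

lemma integral_odd_zero:
  fixes g :: "real \<Rightarrow> real"
  assumes "\<And>x. g (- x) = - g x"
  shows "integral\<^sup>L lborel g = 0"
  using lborel_integral_real_affine[of "-1" g 0] assms by simp

lemma has_bochner_integral_inverse_cube_sqrt:
  "has_bochner_integral lborel (\<lambda>m::real. 1 / ((1 + m\<^sup>2) * sqrt (1 + m\<^sup>2))) 2"
proof -
  have pos: "0 < 1 + m\<^sup>2" for m :: real
    by (simp add: add_pos_nonneg)
  have "has_bochner_integral lborel (\<lambda>m::real. indicator {0..} m *\<^sub>R (1 / ((1 + m\<^sup>2) * sqrt (1 + m\<^sup>2)))) 1"
  proof -
    have lim: "((\<lambda>m::real. m / sqrt (1 + m\<^sup>2)) \<longlongrightarrow> 1) at_top"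
      by real_asymp
    have d: "((\<lambda>m::real. m / sqrt (1 + m\<^sup>2)) has_real_derivative 1 / ((1 + m\<^sup>2) * sqrt (1 + m\<^sup>2))) (at m)" for m
    proof -
      define q where "q = sqrt (1 + m\<^sup>2)"
      have q: "0 < q" "q * q = 1 + m\<^sup>2" using pos[of m] by (auto simp: q_def)
      have "((\<lambda>m::real. m / sqrt (1 + m\<^sup>2)) has_real_derivative
          (1 * q - m * (2 * m * (inverse q / 2))) / (q * q)) (at m)"
        unfolding q_def using pos[of m]
        by (auto intro!: derivative_eq_intros simp: divide_simps)
      moreover have "(1 * q - m * (2 * m * (inverse q / 2))) / (q * q) = (q * q - m\<^sup>2) / (q * q * q)"
        using q(1) by (simp add: divide_simps power2_eq_square)
      moreover have "(q * q - m\<^sup>2) / (q * q * q) = 1 / ((1 + m\<^sup>2) * q)"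
        unfolding q(2) by simp
      ultimately show ?thesis by (simp add: q_def)
    qed
    have "(\<integral>\<^sup>+m. ennreal (1 / ((1 + m\<^sup>2) * sqrt (1 + m\<^sup>2))) * indicator {0..} m \<partial>lborel)
        = ennreal (1 - 0 / sqrt (1 + 0\<^sup>2))"
      by (rule nn_integral_FTC_atLeast[where F = "\<lambda>m::real. m / sqrt (1 + m\<^sup>2)"])
        (use pos in \<open>auto simp: less_imp_le intro!: d lim\<close>)
    moreover have "ennreal (1 / ((1 + m\<^sup>2) * sqrt (1 + m\<^sup>2))) * indicator {0..} m
        = ennreal (1 / ((1 + m\<^sup>2) * sqrt (1 + m\<^sup>2)) * indicator {0..} m)" for m
      by (simp add: indicator_def)
    ultimately have "has_bochner_integral lborel
        (\<lambda>m::real. 1 / ((1 + m\<^sup>2) * sqrt (1 + m\<^sup>2)) * indicator {0..} m) 1"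
      by (intro has_bochner_integral_nn_integral)
        (auto simp: less_imp_le add_nonneg_nonneg)
    then show ?thesis by (simp add: mult.commute)
  qed
  from has_bochner_integral_even_function[OF this] show ?thesis by simp
qed

text \<open>By scaling, the second moment of the Gaussian is proportional to \<open>S * sqrt S\<close>, which the normalisation
of \<open>wall_maxwellian\<close> cancels: the moment along a ray does not depend on the temperature.\<close>

lemma wall_maxwellian_ray_integral:
  assumes S: "0 < S"
  shows "(LINT s|lborel. indicator {0<..} s * (s * (s * wall_maxwellian S (m * s, s))))
    = 1 / 2 * (1 / ((1 + m\<^sup>2) * sqrt (1 + m\<^sup>2)))"
proof -
  define A where "A = (1 + m\<^sup>2) / S"
  have A: "0 < A" using S by (simp add: A_def add_pos_nonneg)
  have n: "(norm (m * s, s))\<^sup>2 / (2 * S) = A * s\<^sup>2 / 2" for s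
    by (simp add: norm_plane_sq A_def power_mult_distrib algebra_simps)
  have e: "indicator {0<..} s * (s * (s * wall_maxwellian S (m * s, s)))
     = 1 / (S * sqrt (2 * pi * S)) * (indicator {0..} s *\<^sub>R (exp (- (A * s\<^sup>2 / 2)) * s\<^sup>2))" for s
  proof (cases "0 < s")
    case True
    then show ?thesis unfolding wall_maxwellian_def n by (simp add: power2_eq_square)
  next
    case False
    then show ?thesis by (cases "s = 0") auto
  qed
  have SA: "S * A = 1 + m\<^sup>2" using S by (simp add: A_def)
  have "1 / (S * sqrt (2 * pi * S)) * (sqrt (pi / 2) / (A * sqrt A))
      = sqrt (pi / 2) / sqrt (2 * pi) / ((S * A) * (sqrt S * sqrt A))"
    using S A by (simp add: real_sqrt_mult)
  also have "sqrt (pi / 2) / sqrt (2 * pi) = sqrt (1 / 4)"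
    by (simp add: real_sqrt_divide[symmetric] del: real_sqrt_divide)
  also have "sqrt (1 / 4 :: real) = 1 / 2"
    by (simp add: real_sqrt_divide)
  also have "sqrt S * sqrt A = sqrt (1 + m\<^sup>2)"
    unfolding real_sqrt_mult[symmetric] SA ..
  finally show ?thesis
    using has_bochner_integral_mult_right[OF halfline_gaussian_moment_two[OF A], of "1 / (S * sqrt (2 * pi * S))"]
    unfolding e SA by (simp add: has_bochner_integral_iff)
qed

lemma plane_coordinates_borel:
  "(fst :: plane \<Rightarrow> real) \<in> borel_measurable borel" "(snd :: plane \<Rightarrow> real) \<in> borel_measurable borel"
  unfolding borel_prod[symmetric] by measurable

text \<open>A temperature that depends on the slope alone is constant on each ray, so the moments are integrals
over \<open>m\<close> of \<open>(1 + m\<^sup>2) powr (- 3 / 2) / 2\<close>, which has integral 1, and of \<open>m\<close> times this even function,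
which has integral 0. The reflection \<open>v \<mapsto> - v\<close> preserves slopes and gives the lower half plane.\<close>

lemma half_plane_moments:
  assumes \<theta> [measurable]: "\<theta> \<in> borel_measurable borel"
    and c: "0 < c" "\<And>m. c \<le> \<theta> m" "\<And>m. \<theta> m \<le> 1"
  defines "F \<equiv> \<lambda>v. wall_maxwellian (\<theta> (fst v / snd v)) v"
  shows "(LINT v:{v. 0 < snd v}|lborel. snd v * F v) = 1"
    and "(LINT v:{v. 0 < snd v}|lborel. fst v * F v) = 0"
    and "(LINT v:{v. snd v < 0}|lborel. snd v * F v) = - 1"
    and "(LINT v:{v. snd v < 0}|lborel. fst v * F v) = 0"
    and "integrable lborel (\<lambda>v. fst v * F v)" and "integrable lborel (\<lambda>v. snd v * F v)"
proof -
  have "(\<lambda>v::plane. fst v / snd v) \<in> borel_measurable borel"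
    by (intro borel_measurable_divide plane_coordinates_borel)
  then have [measurable]: "F \<in> borel_measurable borel"
    unfolding F_def by (intro measurable_wall_maxwellian measurable_compose[OF _ \<theta>]) auto
  have \<theta>0: "0 < \<theta> m" for m using c(1,2) by (rule less_le_trans)
  define K where "K = 1 / (c * sqrt (2 * pi * c))"
  have bound: "\<bar>F v\<bar> \<le> K * exp (- ((norm v)\<^sup>2 / 2))" for v
    unfolding F_def K_def using wall_maxwellian_le[OF c(1) c(2) c(3), of "fst v / snd v" v]
      wall_maxwellian_nonneg[OF \<theta>0, of "fst v / snd v" v] by simp
  have ginti: "integrable lborel (\<lambda>v::plane. K * ((1 + norm v) * exp (- ((norm v)\<^sup>2 / 2))))"
    by (intro integrable_mult_right integrable_gaussian_linear)
  have int: "integrable lborel (\<lambda>v. p v * F v)"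
    if p: "\<And>v. \<bar>p v\<bar> \<le> norm v" and [measurable]: "p \<in> borel_measurable borel" for p :: "plane \<Rightarrow> real"
  proof (rule Bochner_Integration.integrable_bound[OF ginti])
    show "AE v in lborel. norm (p v * F v) \<le> norm (K * ((1 + norm v) * exp (- ((norm v)\<^sup>2 / 2))))"
    proof (rule AE_I2)
      fix v
      have "\<bar>p v\<bar> * \<bar>F v\<bar> \<le> (1 + norm v) * (K * exp (- ((norm v)\<^sup>2 / 2)))"
        using p[of v] by (intro mult_mono bound) auto
      also have "\<dots> \<le> norm (K * ((1 + norm v) * exp (- ((norm v)\<^sup>2 / 2))))"
        using abs_ge_self by (simp add: mult_ac)
      finally show "norm (p v * F v) \<le> norm (K * ((1 + norm v) * exp (- ((norm v)\<^sup>2 / 2))))"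
        by (simp add: abs_mult)
    qed
  qed measurable
  show i: "integrable lborel (\<lambda>v. fst v * F v)" "integrable lborel (\<lambda>v. snd v * F v)"
    using int[of fst] int[of snd] by (simp_all add: norm_prod_def real_le_rsqrt plane_coordinates_borel)
  have slope: "(LINT s|lborel. indicator {0<..} s * (s * (s * F (m * s, s))))
      = 1 / 2 * (1 / ((1 + m\<^sup>2) * sqrt (1 + m\<^sup>2)))" for m
  proof -
    have "(LINT s|lborel. indicator {0<..} s * (s * (s * F (m * s, s))))
        = (LINT s|lborel. indicator {0<..} s * (s * (s * wall_maxwellian (\<theta> m) (m * s, s))))"
      by (rule Bochner_Integration.integral_cong) (auto simp: F_def indicator_def)
    then show ?thesis using wall_maxwellian_ray_integral[OF \<theta>0[of m], of m] by simp
  qed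
  show one: "(LINT v:{v. 0 < snd v}|lborel. snd v * F v) = 1"
    using has_bochner_integral_mult_right[OF has_bochner_integral_inverse_cube_sqrt, of "1 / 2"]
    unfolding integral_plane_slope[OF i(2)] by (simp add: slope has_bochner_integral_iff)
  show zero: "(LINT v:{v. 0 < snd v}|lborel. fst v * F v) = 0"
  proof -
    have "(LINT s|lborel. indicator {0<..} s * (s * (m * s * F (m * s, s))))
        = m * (1 / 2 * (1 / ((1 + m\<^sup>2) * sqrt (1 + m\<^sup>2))))" for m
      unfolding slope[symmetric] by (subst Bochner_Integration.integral_mult_right_zero[symmetric]) (simp add: mult_ac)
    then show ?thesis
      unfolding integral_plane_slope[OF i(1)] by (simp add: integral_odd_zero)
  qed
  have F_even: "F (- v) = F v" for v by (simp add: F_def wall_maxwellian_def)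
  have refl: "(LINT v:{v. snd v < 0}|lborel. p v * F v) = - (LINT v:{v. 0 < snd v}|lborel. p v * F v)"
    if [measurable]: "p \<in> borel_measurable borel" and p: "\<And>v. p (- v) = - p v" for p :: "plane \<Rightarrow> real"
  proof -
    have "(LINT v:{v. snd v < 0}|lborel. p v * F v)
        = (LINT v|lborel. indicator {v. snd v < 0} (- v) * (p (- v) * F (- v)))"
      unfolding set_lebesgue_integral_def
      by (subst integral_plane_uminus[symmetric]) auto
    also have "\<dots> = (LINT v|lborel. - (indicator {v. 0 < snd v} v * (p v * F v)))"
      by (rule Bochner_Integration.integral_cong) (auto simp: p F_even indicator_def)
    finally show ?thesis by (simp add: set_lebesgue_integral_def)
  qed
  show "(LINT v:{v. snd v < 0}|lborel. snd v * F v) = - 1"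
    by (subst refl) (simp_all add: one plane_coordinates_borel)
  show "(LINT v:{v. snd v < 0}|lborel. fst v * F v) = 0"
    by (subst refl) (simp_all add: zero plane_coordinates_borel)
qed

section \<open>Green's identity on the square\<close>

lemma Omega_compact: "compact Omega"
  by (simp add: Omega_def compact_Times)

lemma set_integral_Omega_iterated:
  fixes g :: "plane \<Rightarrow> real"
  assumes g: "continuous_on UNIV g"
  shows "(LINT x:Omega|lborel. g x) = (LINT s:{0..1}|lborel. LINT y:{0..1}|lborel. g (s, y))"
    and "(LINT x:Omega|lborel. g x) = (LINT y:{0..1}|lborel. LINT s:{0..1}|lborel. g (s, y))"
    and "set_integrable lborel {0..1} (\<lambda>s. LINT y:{0..1}|lborel. g (s, y))"
    and "set_integrable lborel {0..1} (\<lambda>y. LINT s:{0..1}|lborel. g (s, y))"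
proof -
  have "integrable lborel (\<lambda>x. indicator Omega x *\<^sub>R g x)"
    by (intro borel_integrable_compact Omega_compact continuous_on_subset[OF g]) auto
  moreover have "indicator Omega x = (indicator {0..1} (fst x) * indicator {0..1} (snd x) :: real)" for x
    by (cases x) (auto simp: Omega_def indicator_def)
  ultimately have i: "integrable (lborel \<Otimes>\<^sub>M lborel)
      (\<lambda>(s, y). indicator {0..1} s * (indicator {0..1} y * g (s, y)))"
    and eq: "(LINT x:Omega|lborel. g x)
      = integral\<^sup>L (lborel \<Otimes>\<^sub>M lborel) (\<lambda>(s, y). indicator {0..1} s * (indicator {0..1} y * g (s, y)))"
    by (simp_all add: lborel_prod set_lebesgue_integral_def case_prod_unfold mult.assoc)
  have sw: "(\<lambda>(s, y). indicator {0..1} s * (indicator {0..1} y * g (s, y)))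
      = (\<lambda>(s, y). indicator {0..1} y * (indicator {0..1} s * g (s, y)))"
    by (auto simp: fun_eq_iff)
  note i' = i[unfolded sw] and eq' = eq[unfolded sw]
  show "(LINT x:Omega|lborel. g x) = (LINT s:{0..1}|lborel. LINT y:{0..1}|lborel. g (s, y))"
    using lborel_pair.integral_fst[OF i] unfolding eq by (simp add: set_lebesgue_integral_def)
  show "(LINT x:Omega|lborel. g x) = (LINT y:{0..1}|lborel. LINT s:{0..1}|lborel. g (s, y))"
    using lborel_pair.integral_snd[OF i'] unfolding eq' by (simp add: set_lebesgue_integral_def)
  show "set_integrable lborel {0..1} (\<lambda>s. LINT y:{0..1}|lborel. g (s, y))"
    using lborel_pair.integrable_fst[OF i] by (simp add: set_lebesgue_integral_def set_integrable_def)
  show "set_integrable lborel {0..1} (\<lambda>y. LINT s:{0..1}|lborel. g (s, y))"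
    using lborel_pair.integrable_snd[OF i'] by (simp add: set_lebesgue_integral_def set_integrable_def)
qed

lemma green_square_C1:
  fixes \<Psi> :: "plane \<Rightarrow> real"
  assumes d: "\<And>x. (\<Psi> has_derivative D x) (at x)" and c: "\<And>h. continuous_on UNIV (\<lambda>x. D x h)"
  shows "(LINT x:Omega|lborel. D x v)
    = (LINT s:{0..1}|lborel. snd v * (\<Psi> (s, 1) - \<Psi> (s, 0)) + fst v * (\<Psi> (1, s) - \<Psi> (0, s)))"
proof -
  have lin: "D x v = fst v * D x (1, 0) + snd v * D x (0, 1)" for x
  proof -
    interpret bounded_linear "D x" using d by (rule has_derivative_bounded_linear)
    have "v = fst v *\<^sub>R (1, 0) + snd v *\<^sub>R (0, 1)" by (simp add: prod_eq_iff)
    then have "D x v = D x (fst v *\<^sub>R (1, 0) + snd v *\<^sub>R (0, 1))" by simp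
    then show ?thesis by (simp add: add scaleR del: scaleR_Pair)
  qed
  have ftc1: "(LINT s:{0..1}|lborel. D (s, y) (1, 0)) = \<Psi> (1, y) - \<Psi> (0, y)" for y
    unfolding set_lebesgue_integral_def
  proof (rule integral_FTC_atLeastAtMost)
    fix s :: real
    have "((\<lambda>s. \<Psi> (s, y)) has_derivative (\<lambda>h. D (s, y) (h, 0))) (at s within {0..1})"
      by (rule has_derivative_compose[where g = \<Psi>, OF _ d]) (auto intro!: derivative_eq_intros)
    moreover have "(\<lambda>h. D (s, y) (h, 0)) = (\<lambda>h. h *\<^sub>R D (s, y) (1, 0))"
    proof
      fix h :: real
      have "(h, 0) = h *\<^sub>R ((1, 0) :: plane)" by simp
      then show "D (s, y) (h, 0) = h *\<^sub>R D (s, y) (1, 0)"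
        by (simp only: linear_cmul[OF has_derivative_linear[OF d]])
    qed
    ultimately show "((\<lambda>s. \<Psi> (s, y)) has_vector_derivative D (s, y) (1, 0)) (at s within {0..1})"
      by (simp only: has_vector_derivative_def)
  next
    show "continuous_on {0..1} (\<lambda>s. D (s, y) (1, 0))"
      by (rule continuous_on_compose2[OF c]) (auto intro!: continuous_intros)
  qed simp
  have ftc2: "(LINT y:{0..1}|lborel. D (s, y) (0, 1)) = \<Psi> (s, 1) - \<Psi> (s, 0)" for s
    unfolding set_lebesgue_integral_def
  proof (rule integral_FTC_atLeastAtMost)
    fix y :: real
    have "((\<lambda>y. \<Psi> (s, y)) has_derivative (\<lambda>h. D (s, y) (0, h))) (at y within {0..1})"
      by (rule has_derivative_compose[where g = \<Psi>, OF _ d]) (auto intro!: derivative_eq_intros)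
    moreover have "(\<lambda>h. D (s, y) (0, h)) = (\<lambda>h. h *\<^sub>R D (s, y) (0, 1))"
    proof
      fix h :: real
      have "(0, h) = h *\<^sub>R ((0, 1) :: plane)" by simp
      then show "D (s, y) (0, h) = h *\<^sub>R D (s, y) (0, 1)"
        by (simp only: linear_cmul[OF has_derivative_linear[OF d]])
    qed
    ultimately show "((\<lambda>y. \<Psi> (s, y)) has_vector_derivative D (s, y) (0, 1)) (at y within {0..1})"
      by (simp only: has_vector_derivative_def)
  next
    show "continuous_on {0..1} (\<lambda>y. D (s, y) (0, 1))"
      by (rule continuous_on_compose2[OF c]) (auto intro!: continuous_intros)
  qed simp
  have i: "set_integrable lborel Omega (\<lambda>x. D x h)" for h
    unfolding set_integrable_def
    by (intro borel_integrable_compact Omega_compact continuous_on_subset[OF c]) auto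
  have "(LINT x:Omega|lborel. D x v) = fst v * (LINT x:Omega|lborel. D x (1, 0)) + snd v * (LINT x:Omega|lborel. D x (0, 1))"
    unfolding lin using i by (simp add: set_integral_add)
  also have "\<dots> = fst v * (LINT s:{0..1}|lborel. \<Psi> (1, s) - \<Psi> (0, s)) + snd v * (LINT s:{0..1}|lborel. \<Psi> (s, 1) - \<Psi> (s, 0))"
    unfolding set_integral_Omega_iterated(2)[OF c[of "(1, 0)"]] set_integral_Omega_iterated(1)[OF c[of "(0, 1)"]]
      ftc1 ftc2 ..
  also have "\<dots> = (LINT s:{0..1}|lborel. snd v * (\<Psi> (s, 1) - \<Psi> (s, 0)) + fst v * (\<Psi> (1, s) - \<Psi> (0, s)))"
    using set_integral_Omega_iterated(4)[OF c[of "(1, 0)"]] set_integral_Omega_iterated(3)[OF c[of "(0, 1)"]]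
    unfolding ftc1 ftc2 by (subst set_integral_add) auto
  finally show ?thesis .
qed

text \<open>Measurable functions are almost everywhere limits of continuous ones. Truncating these at \<open>B\<close> keeps the
limit, and by Weierstrass each of them is uniformly close to a polynomial on \<open>[- R, R]\<close>.\<close>

lemma bounded_borel_ae_limit_of_C1:
  fixes H :: "real \<Rightarrow> real"
  assumes H: "H \<in> borel_measurable borel" and B: "\<And>y. \<bar>H y\<bar> \<le> B"
  obtains p p' N where "\<And>n y. (p n has_real_derivative p' n y) (at y)"
    "\<And>n :: nat. continuous_on UNIV (p' n)"
    "\<And>n y. \<bar>y\<bar> \<le> R \<Longrightarrow> \<bar>p n y\<bar> \<le> B + 1"
    "N \<in> null_sets lborel" "\<And>y. \<bar>y\<bar> \<le> R \<Longrightarrow> y \<notin> N \<Longrightarrow> (\<lambda>n. p n y) \<longlonglongrightarrow> H y"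
proof -
  have "H measurable_on UNIV"
    by (rule lebesgue_measurable_imp_measurable_on_real) (use H in \<open>auto intro: measurable_completion\<close>)
  then obtain N0 g where N0: "negligible N0" and g: "\<And>n. continuous_on UNIV (g n)"
    and lim: "\<And>y. y \<notin> N0 \<Longrightarrow> (\<lambda>n. g n y) \<longlonglongrightarrow> H y"
    by (auto simp: measurable_on_def)
  obtain N where N: "N \<in> null_sets lborel" "N0 \<subseteq> N"
    using N0 by (auto simp: negligible_iff_null_sets null_sets_completion_iff2)
  define k where "k n y = max (- B) (min B (g n y))" for n y
  have k: "continuous_on UNIV (k n)" "\<bar>k n y\<bar> \<le> B" for n y
    using B[of 0] unfolding k_def by (auto intro!: continuous_intros g)
  have klim: "(\<lambda>n. k n y) \<longlonglongrightarrow> H y" if "y \<notin> N0" for y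
  proof -
    have "(\<lambda>n. k n y) \<longlonglongrightarrow> max (- B) (min B (H y))"
      unfolding k_def by (intro tendsto_intros lim that)
    then show ?thesis using B[of y] by (simp add: abs_le_iff)
  qed
  have "\<exists>p p'. (\<forall>y. (p has_real_derivative p' y) (at y)) \<and> continuous_on UNIV p' \<and>
      (\<forall>y\<in>{- R..R}. \<bar>k n y - p y\<bar> < 1 / real (Suc n))" for n
  proof -
    obtain p where p: "real_polynomial_function p" "\<And>y. y \<in> {- R..R} \<Longrightarrow> \<bar>k n y - p y\<bar> < 1 / real (Suc n)"
      by (rule Stone_Weierstrass_real_polynomial_function[of "{- R..R}" "k n" "1 / real (Suc n)"])
        (auto intro: continuous_on_subset[OF k(1)])
    obtain p' where "real_polynomial_function p'" "\<And>y. (p has_real_derivative p' y) (at y)"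
      using has_real_derivative_polynomial_function[OF p(1)] by auto
    moreover have "continuous_on UNIV p'"
      using \<open>real_polynomial_function p'\<close>
      by (simp add: continuous_on_polymonial_function real_polynomial_function_eq)
    ultimately show ?thesis
      using p(2) by blast
  qed
  then obtain p p' where p: "\<And>n y. (p n has_real_derivative p' n y) (at y)" "\<And>n. continuous_on UNIV (p' n)"
    "\<And>n y. y \<in> {- R..R} \<Longrightarrow> \<bar>k n y - p n y\<bar> < 1 / real (Suc n)"
    by metis
  show thesis
  proof (rule that[of p p' N])
    fix n y assume "\<bar>y\<bar> \<le> R"
    then have "\<bar>k n y - p n y\<bar> < 1 / real (Suc n)" by (intro p) auto
    also have "\<dots> \<le> 1" by simp
    finally show "\<bar>p n y\<bar> \<le> B + 1" using k(2)[of n y] by linarith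
  next
    fix y assume y: "\<bar>y\<bar> \<le> R" "y \<notin> N"
    have pk: "\<bar>k n y - p n y\<bar> < 1 / real (Suc n)" for n
      using y by (intro p) auto
    have "(\<lambda>n. k n y - p n y) \<longlonglongrightarrow> 0"
    proof (rule tendsto_rabs_zero_cancel, rule tendsto_sandwich[OF _ _ tendsto_const])
      show "(\<lambda>n. 1 / real (Suc n)) \<longlonglongrightarrow> 0" by (rule LIMSEQ_Suc[OF lim_1_over_n])
    qed (use less_imp_le[OF pk] in \<open>auto intro!: always_eventually simp del: of_nat_Suc\<close>)
    from tendsto_diff[OF klim[of y] this] show "(\<lambda>n. p n y) \<longlonglongrightarrow> H y" using y N by auto
  qed (use p N in auto)
qed

text \<open>For continuously differentiable \<open>H\<close> the identity is \<open>green_square_C1\<close> for the product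
\<open>H (x\<^sub>1 - m x\<^sub>2) \<Phi>\<close>, as the derivative of the first factor in the direction \<open>v\<close> is 0. Both sides
depend continuously on \<open>H\<close> under bounded convergence almost everywhere, so the approximation carries
it over to bounded Borel functions.\<close>

lemma green_square_constant_along_lines:
  fixes H :: "real \<Rightarrow> real" and \<Phi> :: "plane \<Rightarrow> real"
  assumes H: "H \<in> borel_measurable borel" and B: "\<And>y. \<bar>H y\<bar> \<le> B"
    and d: "\<And>x. (\<Phi> has_derivative D x) (at x)" and c: "\<And>h. continuous_on UNIV (\<lambda>x. D x h)"
    and v: "snd v \<noteq> 0"
  defines "m \<equiv> fst v / snd v"
  shows "(LINT x:Omega|lborel. H (fst x - snd x * m) * D x v)
    = (LINT s:{0..1}|lborel. snd v * (H (s - m) * \<Phi> (s, 1) - H s * \<Phi> (s, 0))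
        + fst v * (H (1 - s * m) * \<Phi> (1, s) - H (- (s * m)) * \<Phi> (0, s)))"
proof -
  \<comment> \<open>All arguments of \<open>H\<close> that occur over the square lie in \<open>[- R, R]\<close>.\<close>
  define R where "R = 1 + \<bar>m\<bar>"
  obtain p p' N where p: "\<And>n y. (p n has_real_derivative p' n y) (at y)"
      "\<And>n :: nat. continuous_on UNIV (p' n)"
      "\<And>n y. \<bar>y\<bar> \<le> R \<Longrightarrow> \<bar>p n y\<bar> \<le> B + 1"
    and N: "N \<in> null_sets lborel" and lim: "\<And>y. \<bar>y\<bar> \<le> R \<Longrightarrow> y \<notin> N \<Longrightarrow> (\<lambda>n. p n y) \<longlonglongrightarrow> H y"
    by (rule bounded_borel_ae_limit_of_C1[OF H B, of R]) blast
  have N_borel [measurable]: "N \<in> sets borel" using N by auto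
  have \<Phi>c: "continuous_on UNIV \<Phi>"
    using d by (meson has_derivative_continuous continuous_at_imp_continuous_on)
  have pc: "continuous_on UNIV (p n)" for n
    using p(1) by (meson DERIV_isCont continuous_at_imp_continuous_on)
  have B0: "0 \<le> B" using B[of 0] by linarith
  have avoid: "AE s in lborel. t + e * s \<notin> N" if "e \<noteq> 0" for t e :: real
  proof (rule AE_borel_affine[OF that])
    show "AE s in lborel. s \<notin> N" by (rule AE_not_in[OF N])
  qed measurable
  have strip: "\<bar>s\<bar> \<le> R" "\<bar>s - m\<bar> \<le> R" "\<bar>1 - s * m\<bar> \<le> R" "\<bar>s * m\<bar> \<le> R" "\<bar>x - s * m\<bar> \<le> R"
    if "s \<in> {0..1}" "x \<in> {0..1}" for s x :: real
  proof -
    have "\<bar>s * m\<bar> \<le> \<bar>m\<bar>" using that by (auto simp: abs_mult intro: mult_left_le_one_le)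
    then show "\<bar>s\<bar> \<le> R" "\<bar>s - m\<bar> \<le> R" "\<bar>1 - s * m\<bar> \<le> R" "\<bar>s * m\<bar> \<le> R" "\<bar>x - s * m\<bar> \<le> R"
      using that unfolding R_def by auto
  qed
  define lhs where "lhs h = (LINT x:Omega|lborel. h (fst x - snd x * m) * D x v)" for h :: "real \<Rightarrow> real"
  define bd where "bd h s = snd v * (h (s - m) * \<Phi> (s, 1) - h s * \<Phi> (s, 0))
        + fst v * (h (1 - s * m) * \<Phi> (1, s) - h (- (s * m)) * \<Phi> (0, s))" for h :: "real \<Rightarrow> real" and s
  have smooth: "lhs (p n) = (LINT s:{0..1}|lborel. bd (p n) s)" for n
  proof -
    define E where "E x h = p n (fst x - snd x * m) * D x h
        + p' n (fst x - snd x * m) * (fst h - snd h * m) * \<Phi> x" for x h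
    have E: "((\<lambda>x. p n (fst x - snd x * m) * \<Phi> x) has_derivative E x) (at x)" for x
    proof -
      have "((\<lambda>x. p n (fst x - snd x * m)) has_derivative
          (\<lambda>h. p' n (fst x - snd x * m) * (fst h - snd h * m))) (at x)"
        by (rule has_derivative_compose[where g = "p n", OF _ p(1)[unfolded has_field_derivative_def]])
          (auto intro!: derivative_eq_intros)
      from has_derivative_mult[OF this d[of x]] show ?thesis
        by (simp add: E_def[abs_def])
    qed
    have "continuous_on UNIV (\<lambda>x. E x h)" for h
    proof -
      have "continuous_on UNIV (\<lambda>x. p n (fst x - snd x * m))" "continuous_on UNIV (\<lambda>x. p' n (fst x - snd x * m))"
        by (rule continuous_on_compose2[OF pc] continuous_on_compose2[OF p(2)]; auto intro!: continuous_intros)+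
      then show ?thesis unfolding E_def by (intro continuous_intros c \<Phi>c)
    qed
    from green_square_C1[OF E this, of v] have "(LINT x:Omega|lborel. E x v) = (LINT s:{0..1}|lborel.
        snd v * (p n (fst (s, 1) - snd (s, 1) * m) * \<Phi> (s, 1) - p n (fst (s, 0) - snd (s, 0) * m) * \<Phi> (s, 0))
        + fst v * (p n (fst (1, s) - snd (1, s) * m) * \<Phi> (1, s) - p n (fst (0, s) - snd (0, s) * m) * \<Phi> (0, s)))"
      by simp
    moreover have "E x v = p n (fst x - snd x * m) * D x v" for x
      using v by (simp add: E_def m_def)
    ultimately show ?thesis by (simp add: lhs_def bd_def)
  qed
  have "(\<lambda>n. lhs (p n)) \<longlonglongrightarrow> lhs H"
  proof -
    obtain M where M: "\<And>x. x \<in> Omega \<Longrightarrow> \<bar>D x v\<bar> \<le> M"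
      using compact_imp_bounded[OF compact_continuous_image[OF continuous_on_subset[OF c[of v]] Omega_compact]]
      by (auto simp: bounded_iff)
    have ae: "AE x in (lborel :: plane measure). fst x - snd x * m \<notin> N"
    proof -
      have "AE x in (lborel \<Otimes>\<^sub>M lborel). fst x - snd x * m \<notin> N"
      proof (rule lborel_pair.AE_pair_measure)
        show "AE s in lborel. AE y in lborel. fst (s, y) - snd (s, y) * m \<notin> N"
        proof (cases "m = 0")
          case True
          have "AE s in lborel. s \<notin> N" using avoid[of 1 0] by simp
          then show ?thesis
            by eventually_elim (simp add: True)
        next
          case False
          then show ?thesis using avoid[of "- m"] by (simp add: mult.commute)
        qed
      qed measurable
      then show ?thesis unfolding lborel_prod .
    qed
    have [measurable]: "(\<lambda>x. h (fst x - snd x * m)) \<in> borel_measurable (borel :: plane measure)"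
      if "h \<in> borel_measurable borel" for h :: "real \<Rightarrow> real"
      by (rule measurable_compose[OF _ that])
        (auto intro!: borel_measurable_continuous_onI continuous_intros)
    have [measurable]: "(\<lambda>x. D x v) \<in> borel_measurable borel"
      by (rule borel_measurable_continuous_onI[OF c])
    have [measurable]: "Omega \<in> sets borel"
      using Omega_compact by (simp add: borel_compact)
    have pm: "p n \<in> borel_measurable borel" for n by (rule borel_measurable_continuous_onI[OF pc])
    show ?thesis
      unfolding lhs_def set_lebesgue_integral_def
    proof (rule integral_dominated_convergence[where w = "\<lambda>x. indicator Omega x *\<^sub>R ((B + 1) * M)"])
      show "integrable lborel (\<lambda>x::plane. indicator Omega x *\<^sub>R ((B + 1) * M))"
        by (intro borel_integrable_compact Omega_compact continuous_intros)
      show "AE x in lborel. (\<lambda>n. indicator Omega x *\<^sub>R (p n (fst x - snd x * m) * D x v))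
          \<longlonglongrightarrow> indicator Omega x *\<^sub>R (H (fst x - snd x * m) * D x v)"
        using ae
      proof eventually_elim
        case (elim x)
        show ?case
        proof (cases "x \<in> Omega")
          case True
          then have "\<bar>fst x - snd x * m\<bar> \<le> R" by (intro strip) (auto simp: Omega_def)
          then show ?thesis using elim by (intro tendsto_intros lim)
        qed simp
      qed
      show "AE x in lborel. norm (indicator Omega x *\<^sub>R (p n (fst x - snd x * m) * D x v))
          \<le> indicator Omega x *\<^sub>R ((B + 1) * M)" for n
      proof (rule AE_I2)
        fix x
        show "norm (indicator Omega x *\<^sub>R (p n (fst x - snd x * m) * D x v)) \<le> indicator Omega x *\<^sub>R ((B + 1) * M)"
        proof (cases "x \<in> Omega")
          case True
          then have "\<bar>fst x - snd x * m\<bar> \<le> R" by (intro strip) (auto simp: Omega_def)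
          then show ?thesis using True B0 by (auto simp: abs_mult intro!: mult_mono p M)
        qed simp
      qed
    qed (use H pm in measurable)
  qed
  moreover have "(\<lambda>n. LINT s:{0..1}|lborel. bd (p n) s) \<longlonglongrightarrow> (LINT s:{0..1}|lborel. bd H s)"
  proof -
    have cs: "continuous_on UNIV (\<lambda>s. \<Phi> (s, 1))" "continuous_on UNIV (\<lambda>s. \<Phi> (s, 0))"
      "continuous_on UNIV (\<lambda>s. \<Phi> (1, s))" "continuous_on UNIV (\<lambda>s. \<Phi> (0, s))"
      by (rule continuous_on_compose2[OF \<Phi>c]; auto intro!: continuous_intros)+
    note [measurable] = cs[THEN borel_measurable_continuous_onI]
    have bm: "bd h \<in> borel_measurable borel" if [measurable]: "h \<in> borel_measurable borel" for h
      unfolding bd_def by measurable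
    have pm: "p n \<in> borel_measurable borel" for n by (rule borel_measurable_continuous_onI[OF pc])
    define w where "w s = \<bar>snd v\<bar> * ((B + 1) * \<bar>\<Phi> (s, 1)\<bar> + (B + 1) * \<bar>\<Phi> (s, 0)\<bar>)
        + \<bar>fst v\<bar> * ((B + 1) * \<bar>\<Phi> (1, s)\<bar> + (B + 1) * \<bar>\<Phi> (0, s)\<bar>)" for s
    \<comment> \<open>For \<open>m = 0\<close> the profile is constant on the vertical sides and its value there could be exceptional, but the flux through them is 0 in that case.\<close>
    have ae: "AE s in lborel. s - m \<notin> N \<and> s \<notin> N \<and> (m \<noteq> 0 \<longrightarrow> 1 - s * m \<notin> N \<and> - (s * m) \<notin> N)"
      using avoid[of 1 "- m"] avoid[of 1 0] avoid[of "- m" 1] avoid[of "- m" 0]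
      by (cases "m = 0") (auto simp: mult.commute)
    show ?thesis
      unfolding set_lebesgue_integral_def
    proof (rule integral_dominated_convergence[where w = "\<lambda>s. indicator {0..1} s *\<^sub>R w s"])
      show "integrable lborel (\<lambda>s. indicator {0..1} s *\<^sub>R w s)"
        unfolding w_def by (intro borel_integrable_compact continuous_intros continuous_on_subset[OF cs(1)]
          continuous_on_subset[OF cs(2)] continuous_on_subset[OF cs(3)] continuous_on_subset[OF cs(4)]) auto
      show "AE s in lborel. (\<lambda>n. indicator {0..1} s *\<^sub>R bd (p n) s) \<longlonglongrightarrow> indicator {0..1} s *\<^sub>R bd H s"
        using ae
      proof eventually_elim
        case (elim s)
        show ?case
        proof (cases "s \<in> {0..1}")
          case True
          note st = strip[OF True True]
          have "(\<lambda>n. fst v * (p n (1 - s * m) * \<Phi> (1, s) - p n (- (s * m)) * \<Phi> (0, s)))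
              \<longlonglongrightarrow> fst v * (H (1 - s * m) * \<Phi> (1, s) - H (- (s * m)) * \<Phi> (0, s))"
          proof (cases "m = 0")
            case True
            then show ?thesis using v by (simp add: m_def)
          next
            case False
            then show ?thesis using elim st by (intro tendsto_intros lim) auto
          qed
          moreover have "(\<lambda>n. snd v * (p n (s - m) * \<Phi> (s, 1) - p n s * \<Phi> (s, 0)))
              \<longlonglongrightarrow> snd v * (H (s - m) * \<Phi> (s, 1) - H s * \<Phi> (s, 0))"
            using elim st by (intro tendsto_intros lim) auto
          ultimately have "(\<lambda>n. bd (p n) s) \<longlonglongrightarrow> bd H s"
            unfolding bd_def by (rule tendsto_add[rotated])
          then show ?thesis by (intro tendsto_intros)
        qed simp
      qed
      show "AE s in lborel. norm (indicator {0..1} s *\<^sub>R bd (p n) s) \<le> indicator {0..1} s *\<^sub>R w s" for n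
      proof (rule AE_I2)
        fix s :: real
        show "norm (indicator {0..1} s *\<^sub>R bd (p n) s) \<le> indicator {0..1} s *\<^sub>R w s"
        proof (cases "s \<in> {0..1}")
          case True
          note st = strip[OF True True]
          have t: "\<bar>a * (p n y * \<phi> - p n z * \<psi>)\<bar> \<le> \<bar>a\<bar> * ((B + 1) * \<bar>\<phi>\<bar> + (B + 1) * \<bar>\<psi>\<bar>)"
            if "\<bar>y\<bar> \<le> R" "\<bar>z\<bar> \<le> R" for a y z \<phi> \<psi>
            unfolding abs_mult
            by (intro mult_left_mono order_trans[OF abs_triangle_ineq4] add_mono)
              (auto simp: abs_mult intro!: mult_right_mono p that)
          have "\<bar>bd (p n) s\<bar> \<le> w s"
            unfolding bd_def w_def
            by (intro order_trans[OF abs_triangle_ineq] add_mono t) (use st in auto)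
          then show ?thesis using True by simp
        qed simp
      qed
    qed (use bm[OF H] bm[OF pm] in measurable)
  qed
  ultimately have "lhs H = (LINT s:{0..1}|lborel. bd H s)"
    unfolding smooth by (rule LIMSEQ_unique)
  then show ?thesis by (simp add: lhs_def bd_def)
qed

section \<open>Weak solutions that are constant along lines\<close>

lemma integrable_bounded_compact_support:
  fixes u :: "'a::euclidean_space \<Rightarrow> real"
  assumes C: "compact C" and [measurable]: "u \<in> borel_measurable borel"
    and M: "\<And>z. z \<in> C \<Longrightarrow> \<bar>u z\<bar> \<le> M" and z: "\<And>z. z \<notin> C \<Longrightarrow> u z = 0"
  shows "integrable lborel u"
proof (rule Bochner_Integration.integrable_bound)
  show "integrable lborel (\<lambda>z. indicator C z *\<^sub>R M)"
    by (intro borel_integrable_compact C continuous_intros)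
  show "AE x in lborel. norm (u x) \<le> norm (indicator C x *\<^sub>R M)"
    using M z by (intro AE_I2) (fastforce simp: indicator_def)
qed simp

lemma integrable_prod_mult:
  fixes f :: "'a::euclidean_space \<Rightarrow> real" and g :: "'b::euclidean_space \<Rightarrow> real"
  assumes "integrable lborel f" "integrable lborel g"
  shows "integrable lborel (\<lambda>u. f (fst u) * g (snd u))"
  using has_bochner_integral_prod_mult[OF has_bochner_integral_integrable[OF assms(1)]
    has_bochner_integral_integrable[OF assms(2)]] by (rule integrable.intros)

text \<open>This compares an integral over the interior with an integral over the boundary: the position ranges
over spaces of different dimension, time and velocity are common to both.\<close>

lemma integral_eq_by_slices:
  fixes u :: "real \<times> 'a::euclidean_space \<times> plane \<Rightarrow> real" and w :: "real \<times> 'b::euclidean_space \<times> plane \<Rightarrow> real"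
  assumes u: "integrable lborel u" and w: "integrable lborel w"
    and eq: "\<And>t. AE v in lborel. (LINT y|lborel. u (t, y, v)) = (LINT y|lborel. w (t, y, v))"
  shows "integral\<^sup>L lborel u = integral\<^sup>L lborel w"
proof -
  have u': "integrable (lborel \<Otimes>\<^sub>M lborel) u" and w': "integrable (lborel \<Otimes>\<^sub>M lborel) w"
    using u w by (simp_all add: lborel_prod)
  have "integral\<^sup>L lborel u = (LINT t|lborel. LINT z|lborel. u (t, z))"
    using lborel_pair.integral_fst'[OF u'] by (simp add: lborel_prod)
  also have "\<dots> = (LINT t|lborel. LINT z|lborel. w (t, z))"
  proof (rule integral_cong_AE)
    show "(\<lambda>t. LINT z|lborel. u (t, z)) \<in> borel_measurable lborel"
      by (rule borel_measurable_integrable[OF lborel_pair.integrable_fst'[OF u']])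
    show "(\<lambda>t. LINT z|lborel. w (t, z)) \<in> borel_measurable lborel"
      by (rule borel_measurable_integrable[OF lborel_pair.integrable_fst'[OF w']])
    show "AE t in lborel. (LINT z|lborel. u (t, z)) = (LINT z|lborel. w (t, z))"
      using lborel_pair.AE_integrable_fst'[OF u'] lborel_pair.AE_integrable_fst'[OF w']
    proof eventually_elim
      case (elim t)
      have ui: "integrable (lborel \<Otimes>\<^sub>M lborel) (\<lambda>(y, v). u (t, y, v))"
        and wi: "integrable (lborel \<Otimes>\<^sub>M lborel) (\<lambda>(y, v). w (t, y, v))"
        using elim by (simp_all add: lborel_prod case_prod_unfold)
      have "(LINT z|lborel. u (t, z)) = (LINT v|lborel. LINT y|lborel. u (t, y, v))"
        using lborel_pair.integral_snd[OF ui] by (simp add: lborel_prod case_prod_unfold)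
      also have "\<dots> = (LINT v|lborel. LINT y|lborel. w (t, y, v))"
        by (rule integral_cong_AE)
          (use eq borel_measurable_integrable[OF lborel_pair.integrable_snd[OF ui]]
            borel_measurable_integrable[OF lborel_pair.integrable_snd[OF wi]] in auto)
      also have "\<dots> = (LINT z|lborel. w (t, z))"
        using lborel_pair.integral_snd[OF wi] by (simp add: lborel_prod case_prod_unfold)
      finally show ?case .
    qed
  qed
  also have "\<dots> = integral\<^sup>L lborel w"
    using lborel_pair.integral_fst'[OF w'] by (simp add: lborel_prod)
  finally show ?thesis .
qed

lemma frechet_derivative_outside_support:
  fixes \<phi> :: "'a::real_normed_vector \<Rightarrow> real"
  assumes "z \<notin> closure {z. \<phi> z \<noteq> 0}"
  shows "\<phi> z = 0" "frechet_derivative \<phi> (at z) = (\<lambda>h. 0)"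
proof -
  have zero: "\<phi> y = 0" if "y \<in> - closure {z. \<phi> z \<noteq> 0}" for y
    using that closure_subset[of "{z. \<phi> z \<noteq> 0}"] by blast
  have z: "z \<in> - closure {z. \<phi> z \<noteq> 0}" unfolding Compl_iff by (rule assms)
  show "\<phi> z = 0" by (rule zero[OF z])
  have "(\<phi> has_derivative (\<lambda>h. 0)) (at z)"
  proof (rule has_derivative_transform_within_open)
    show "((\<lambda>z. 0 :: real) has_derivative (\<lambda>h. 0)) (at z)" by (rule has_derivative_const)
    show "open (- closure {z. \<phi> z \<noteq> 0})" by (rule open_Compl[OF closed_closure])
    show "z \<in> - closure {z. \<phi> z \<noteq> 0}" by (rule z)
    show "0 = \<phi> y" if "y \<in> - closure {z. \<phi> z \<noteq> 0}" for y by (rule zero[OF that, symmetric])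
  qed
  then show "frechet_derivative \<phi> (at z) = (\<lambda>h. 0)"
    by (rule frechet_derivative_at[symmetric])
qed

lemma AE_plane_snd_nonzero: "AE v in (lborel :: plane measure). snd v \<noteq> 0"
proof -
  have "AE v in (lborel \<Otimes>\<^sub>M lborel). snd v \<noteq> (0 :: real)"
  proof (rule lborel_pair.AE_pair_measure)
    show "{v \<in> space (lborel \<Otimes>\<^sub>M lborel). snd v \<noteq> (0 :: real)} \<in> sets (lborel \<Otimes>\<^sub>M lborel)"
      by measurable
  qed (simp add: AE_lborel_singleton)
  then show ?thesis unfolding lborel_prod .
qed

lemma phase_projections_borel:
  "(\<lambda>z. snd (snd z)) \<in> (borel :: (real \<times> 'a::euclidean_space \<times> plane) measure) \<rightarrow>\<^sub>M borel"
  "(\<lambda>z. fst (snd z)) \<in> (borel :: (real \<times> 'a::euclidean_space \<times> plane) measure) \<rightarrow>\<^sub>M borel"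
  by (auto intro!: borel_measurable_continuous_onI continuous_intros)

lemma measurable_line_profile:
  fixes H :: "plane \<Rightarrow> real \<Rightarrow> real"
  assumes H: "(\<lambda>(v, y). H v y) \<in> borel_measurable borel"
    and a: "a \<in> M \<rightarrow>\<^sub>M (borel :: plane measure)" and b: "b \<in> M \<rightarrow>\<^sub>M (borel :: plane measure)"
  shows "(\<lambda>z. H (b z) (fst (a z) - snd (a z) * (fst (b z) / snd (b z)))) \<in> borel_measurable M"
proof -
  note c = measurable_compose[OF a plane_coordinates_borel(1)] measurable_compose[OF a plane_coordinates_borel(2)]
    measurable_compose[OF b plane_coordinates_borel(1)] measurable_compose[OF b plane_coordinates_borel(2)]
  have "(\<lambda>z. (b z, fst (a z) - snd (a z) * (fst (b z) / snd (b z)))) \<in> M \<rightarrow>\<^sub>M borel"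
    by (intro borel_measurable_Pair b borel_measurable_diff borel_measurable_times borel_measurable_divide c)
  from measurable_compose[OF this H] show ?thesis by simp
qed

lemma integrable_compact_times_gaussian:
  fixes C :: "'a::euclidean_space set"
  assumes C: "compact C"
  shows "integrable lborel (\<lambda>w::'a \<times> plane. indicator C (fst w) *
      (K * ((1 + norm (snd w)) * exp (- ((norm (snd w))\<^sup>2 / 2)))))"
  using borel_integrable_compact[OF C continuous_on_const, of "1::real"]
  by (intro integrable_prod_mult[where f = "indicator C" and g = "\<lambda>v. K * ((1 + norm v) * exp (- ((norm v)\<^sup>2 / 2)))"]
      integrable_mult_right integrable_gaussian_linear) simp_all

lemma set_integrable_time_slab:
  fixes C :: "'a::euclidean_space set" and u :: "real \<times> 'a \<times> plane \<Rightarrow> real"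
  assumes C: "compact C" and u: "u \<in> borel_measurable borel"
    and le: "\<And>t y v. y \<in> C \<Longrightarrow> \<bar>u (t, y, v)\<bar> \<le> K * ((1 + norm v) * exp (- ((norm v)\<^sup>2 / 2)))"
  shows "set_integrable lborel ({0..\<tau>} \<times> C \<times> UNIV) u"
proof -
  from integrable_compact_times_gaussian[OF C, of K] have "integrable lborel (\<lambda>z::real \<times> 'a \<times> plane. indicator {0..\<tau>} (fst z) *
      (indicator C (fst (snd z)) * (K * ((1 + norm (snd (snd z))) * exp (- ((norm (snd (snd z)))\<^sup>2 / 2))))))"
    using borel_integrable_compact[OF compact_Icc continuous_on_const, of 0 \<tau> "1::real"]
    by (intro integrable_prod_mult[where f = "indicator {0..\<tau>}" and g = "\<lambda>w. indicator C (fst w) *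
          (K * ((1 + norm (snd w)) * exp (- ((norm (snd w))\<^sup>2 / 2))))"]) simp_all
  then show ?thesis
    unfolding set_integrable_def
  proof (rule Bochner_Integration.integrable_bound)
    have "{0..\<tau>} \<times> C \<times> UNIV \<in> sets (borel :: (real \<times> 'a \<times> plane) measure)"
      by (rule borel_closed[OF closed_Times[OF closed_atLeastAtMost closed_Times[OF compact_imp_closed[OF C] closed_UNIV]]])
    then show "(\<lambda>z. indicator ({0..\<tau>} \<times> C \<times> UNIV) z *\<^sub>R u z) \<in> borel_measurable lborel"
      using u by simp
    show "AE z in lborel. norm (indicator ({0..\<tau>} \<times> C \<times> UNIV) z *\<^sub>R u z)
      \<le> norm (indicator {0..\<tau>} (fst z) *
        (indicator C (fst (snd z)) * (K * ((1 + norm (snd (snd z))) * exp (- ((norm (snd (snd z)))\<^sup>2 / 2))))))"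
    proof (rule AE_I2)
      fix z :: "real \<times> 'a \<times> plane"
      obtain t y v where z: "z = (t, y, v)" by (cases z)
      show "norm (indicator ({0..\<tau>} \<times> C \<times> UNIV) z *\<^sub>R u z)
        \<le> norm (indicator {0..\<tau>} (fst z) *
          (indicator C (fst (snd z)) * (K * ((1 + norm (snd (snd z))) * exp (- ((norm (snd (snd z)))\<^sup>2 / 2))))))"
      proof (cases "t \<in> {0..\<tau>} \<and> y \<in> C")
        case True
        then show ?thesis using order_trans[OF le[of y t v] abs_ge_self] by (simp add: z)
      next
        case False
        then show ?thesis by (auto simp: z)
      qed
    qed
  qed
qed

text \<open>The time derivative of a test function integrates to 0 over \<open>t\<close> because \<open>f\<close> does not depend on time.
The spatial part is Green's identity on the square for each \<open>t\<close> and almost every \<open>v\<close>. Both a test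
function and its derivative vanish for \<open>t \<le> 0\<close> and outside a compact set, so the restriction to
\<open>t > 0\<close> can be dropped and every integral in question converges absolutely. For \<open>v\<^sub>2 = 0\<close> the
argument of \<open>H\<close> contains a division by 0, with value 0; such velocities form a null set.\<close>

lemma weak_free_transport_line_profile:
  fixes H :: "plane \<Rightarrow> real \<Rightarrow> real" and f :: "plane \<Rightarrow> plane \<Rightarrow> real"
  assumes H: "(\<lambda>(v, y). H v y) \<in> borel_measurable borel"
    and bound: "\<And>v y. \<bar>H v y\<bar> \<le> K * exp (- ((norm v)\<^sup>2 / 2))"
    and f: "\<And>x v. x \<in> Omega \<Longrightarrow> f x v = H v (fst x - snd x * (fst v / snd v))"
  shows "weak_free_transport (\<lambda>t. f)"
proof -
  define F where "F x v = H v (fst x - snd x * (fst v / snd v))" for x v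
  have K0: "0 \<le> K" using bound[of 0 0] by simp
  have FK: "\<bar>F x v\<bar> \<le> K" for x v
    using bound[of v "fst x - snd x * (fst v / snd v)"] K0
    by (auto simp: F_def intro!: order_trans[OF bound] mult_left_le)
  note F_borel = measurable_line_profile[OF H, folded F_def]
  have Omega_borel: "Omega \<in> sets borel" using Omega_compact by (simp add: borel_compact)
  have side: "(s, 1) \<in> Omega" "(s, 0) \<in> Omega" "(1, s) \<in> Omega" "(0, s) \<in> Omega" if "s \<in> {0..1}" for s
    using that by (auto simp: Omega_def)
  note proj = phase_projections_borel
  have pc: "continuous_on UNIV (\<lambda>s::real. (s, a :: real))" "continuous_on UNIV (\<lambda>s::real. (a :: real, s))" for a
    by (auto intro!: continuous_intros)
  have nn: "norm (0 :: real, 1 :: real) = 1" "norm (0 :: real, - 1 :: real) = 1"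
    "norm (1 :: real, 0 :: real) = 1" "norm (- 1 :: real, 0 :: real) = 1"
    by (simp_all add: norm_prod_def)
  have interior: "set_integrable lborel ({0..\<tau>} \<times> Omega \<times> UNIV) (\<lambda>(t, x, v). f x v)" for \<tau> :: real
  proof -
    have "set_integrable lborel ({0..\<tau>} \<times> Omega \<times> UNIV) (\<lambda>z :: real \<times> plane \<times> plane. F (fst (snd z)) (snd (snd z)))"
    proof (rule set_integrable_time_slab[OF Omega_compact F_borel[OF proj(2) proj(1)]])
      fix t :: real and x v :: plane
      have "\<bar>F x v\<bar> \<le> 1 * (K * exp (- ((norm v)\<^sup>2 / 2)))" using bound by (simp add: F_def)
      also have "\<dots> \<le> (1 + norm v) * (K * exp (- ((norm v)\<^sup>2 / 2)))"
        using K0 by (intro mult_right_mono) auto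
      finally show "\<bar>F (fst (snd (t, x, v))) (snd (snd (t, x, v)))\<bar> \<le> K * ((1 + norm v) * exp (- ((norm v)\<^sup>2 / 2)))"
        by (simp add: mult_ac)
    qed
    moreover have "f x v = F x v" if "x \<in> Omega" for x v using f[OF that] by (simp add: F_def)
    ultimately show ?thesis
      by (subst set_integrable_cong[OF refl refl, where f' = "\<lambda>z. F (fst (snd z)) (snd (snd z))"]) auto
  qed
  have sides: "side_flux_integrable p n (\<lambda>t. f)"
    if p: "continuous_on UNIV p" "\<And>s. s \<in> {0..1} \<Longrightarrow> p s \<in> Omega" and n: "norm n = 1" for p :: "real \<Rightarrow> plane" and n
    unfolding side_flux_integrable_def
  proof (intro allI impI)
    fix \<tau> :: real
    have pm: "(\<lambda>z. p (fst (snd z))) \<in> (borel :: (real \<times> real \<times> plane) measure) \<rightarrow>\<^sub>M borel"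
      by (rule measurable_compose[OF proj(2) borel_measurable_continuous_onI[OF p(1)]])
    have "set_integrable lborel ({0..\<tau>} \<times> {0..1} \<times> UNIV)
        (\<lambda>z :: real \<times> real \<times> plane. (snd (snd z) \<bullet> n) * F (p (fst (snd z))) (snd (snd z)))"
    proof (rule set_integrable_time_slab)
      show "(\<lambda>z :: real \<times> real \<times> plane. (snd (snd z) \<bullet> n) * F (p (fst (snd z))) (snd (snd z))) \<in> borel_measurable borel"
        by (intro borel_measurable_times F_borel pm proj)
          (auto intro!: borel_measurable_continuous_onI continuous_intros)
      fix t s :: real and v :: plane
      have "\<bar>v \<bullet> n\<bar> * \<bar>F (p s) v\<bar> \<le> (1 + norm v) * (K * exp (- ((norm v)\<^sup>2 / 2)))"
        using Cauchy_Schwarz_ineq2[of v n] n bound by (intro mult_mono) (auto simp: F_def)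
      then show "\<bar>(snd (snd (t, s, v)) \<bullet> n) * F (p (fst (snd (t, s, v)))) (snd (snd (t, s, v)))\<bar>
          \<le> K * ((1 + norm v) * exp (- ((norm v)\<^sup>2 / 2)))"
        by (simp add: abs_mult mult_ac)
    qed simp
    moreover have "f (p s) v = F (p s) v" if "s \<in> {0..1}" for s v using f[OF p(2)[OF that]] by (simp add: F_def)
    ultimately show "set_integrable lborel ({0..\<tau>} \<times> {0..1} \<times> UNIV) (\<lambda>(t, s, v). (v \<bullet> n) * f (p s) v)"
      by (subst set_integrable_cong[OF refl refl,
          where f' = "\<lambda>z. (snd (snd z) \<bullet> n) * F (p (fst (snd z))) (snd (snd z))"]) auto
  qed
  have green: "set_lebesgue_integral (lborel :: (real \<times> plane \<times> plane) measure) ({0<..} \<times> Omega \<times> UNIV)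
          (\<lambda>(t, x, v). f x v * frechet_derivative \<phi> (at (t, x, v)) (1, v, 0))
        = side_flux (\<lambda>s. (s, 1)) (0, 1) (\<lambda>t. f) \<phi> + side_flux (\<lambda>s. (s, 0)) (0, -1) (\<lambda>t. f) \<phi>
          + side_flux (\<lambda>s. (1, s)) (1, 0) (\<lambda>t. f) \<phi> + side_flux (\<lambda>s. (0, s)) (-1, 0) (\<lambda>t. f) \<phi>"
    if \<phi>: "test_function \<phi>" for \<phi>
  proof -
    define D where "D z h = frechet_derivative \<phi> (at z) h" for z h
    define C where "C = closure {z. \<phi> z \<noteq> 0}"
    note tf = \<phi>[unfolded test_function_def]
    have D: "(\<phi> has_derivative D z) (at z)" for z
      using spec[OF tf[THEN conjunct1], of z] unfolding D_def by (simp only: frechet_derivative_works)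
    have Dc: "continuous_on UNIV (\<lambda>z. D z h)" for h
      using tf[THEN conjunct2, THEN conjunct1] unfolding D_def by (rule spec)
    have C1: "compact C" and C2: "C \<subseteq> {z. 0 < fst z}"
      unfolding C_def by (rule tf[THEN conjunct2, THEN conjunct2, THEN conjunct1]
        tf[THEN conjunct2, THEN conjunct2, THEN conjunct2])+
    have C: "compact C" "\<And>z. z \<in> C \<Longrightarrow> 0 < fst z"
      using C1 subsetD[OF C2] by (simp_all only: mem_Collect_eq)
    have C0: "\<phi> z = 0" "D z h = 0" if "z \<notin> C" for z h
      using frechet_derivative_outside_support[of z \<phi>] that by (simp_all only: C_def D_def not_False_eq_True)
    obtain R where R: "0 < R" "\<And>z. z \<in> C \<Longrightarrow> norm z \<le> R"
      using compact_imp_bounded[OF C(1)] unfolding bounded_pos by metis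
    have \<phi>c: "continuous_on UNIV \<phi>"
      by (rule has_derivative_continuous_on[OF has_derivative_at_withinI[OF D]])
    have C_bound: "\<exists>M\<ge>0. \<forall>z. \<bar>g z\<bar> \<le> M" if gc: "continuous_on UNIV g" and g0: "\<And>z. z \<notin> C \<Longrightarrow> g z = 0" for g :: "real \<times> plane \<times> plane \<Rightarrow> real"
    proof -
      have "bounded (g ` C)"
        by (rule compact_imp_bounded[OF compact_continuous_image[OF continuous_on_subset[OF gc subset_UNIV] C(1)]])
      then obtain M where M: "0 < M" "\<forall>y\<in>g ` C. norm y \<le> M" unfolding bounded_pos by metis
      have "\<bar>g z\<bar> \<le> M" for z
      proof (cases "z \<in> C")
        case True
        then show ?thesis using M(2)[THEN bspec, OF imageI[of z C g]] by simp
      next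
        case False
        then show ?thesis using g0[OF False] M(1) by simp
      qed
      then show ?thesis using less_imp_le[OF M(1)] by metis
    qed
    obtain M where M: "0 \<le> M" "\<And>z. \<bar>\<phi> z\<bar> \<le> M" using C_bound[OF \<phi>c C0(1)] by metis
    \<comment> \<open>Time and space parts of the derivative along the transport direction.\<close>
    define gt where "gt z = D z (1, 0, 0)" for z
    define gx where "gx z = D z (0, snd (snd z), 0)" for z
    have lin: "D (t, x, v) (1, v, 0) = gt (t, x, v) + gx (t, x, v)" for t x v
      using linear_add[OF has_derivative_linear[OF D], of "(t, x, v)" "(1, 0, 0)" "(0, v, 0)"]
      by (simp add: gt_def gx_def)
    have gtc: "continuous_on UNIV gt" unfolding gt_def by (rule Dc)
    have gxc: "continuous_on UNIV gx"
    proof -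
      have "gx z = fst (snd (snd z)) * D z (0, (1, 0), 0) + snd (snd (snd z)) * D z (0, (0, 1), 0)" for z
      proof -
        have "(0 :: real, snd (snd z), 0 :: plane)
            = fst (snd (snd z)) *\<^sub>R (0, (1, 0), 0) + snd (snd (snd z)) *\<^sub>R (0, (0, 1), 0)"
          by (simp add: prod_eq_iff)
        then show ?thesis
          unfolding gx_def by (simp only: linear_add[OF has_derivative_linear[OF D]]
            linear_cmul[OF has_derivative_linear[OF D]] real_scaleR_def)
      qed
      then have "gx = (\<lambda>z. fst (snd (snd z)) * D z (0, (1, 0), 0) + snd (snd (snd z)) * D z (0, (0, 1), 0))" by blast
      then show ?thesis by (auto intro!: continuous_intros Dc)
    qed
    \<comment> \<open>The integrands over the whole time axis: over the square and, as \<open>bs\<close> below, over one of its sides.\<close>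
    define vol where "vol g z = indicator Omega (fst (snd z)) * (F (fst (snd z)) (snd (snd z)) * g z)"
      for g :: "real \<times> plane \<times> plane \<Rightarrow> real" and z
    have vol_int: "integrable lborel (vol g)" if g: "continuous_on UNIV g" "\<And>z. z \<notin> C \<Longrightarrow> g z = 0" for g
    proof -
      obtain N where N: "0 \<le> N" "\<And>z. \<bar>g z\<bar> \<le> N" using C_bound[OF g] by metis
      show ?thesis
      proof (rule integrable_bounded_compact_support[OF C(1)])
        have "(\<lambda>z. indicator Omega (fst (snd z)) :: real) \<in> borel_measurable (borel :: (real \<times> plane \<times> plane) measure)"
          by (rule measurable_compose[OF proj(2) borel_measurable_indicator[OF Omega_borel]])
        then show "vol g \<in> borel_measurable borel"
          unfolding vol_def[abs_def]
          by (intro borel_measurable_times F_borel proj borel_measurable_continuous_onI[OF g(1)])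
        fix z
        have "\<bar>F (fst (snd z)) (snd (snd z))\<bar> * \<bar>g z\<bar> \<le> K * N"
          by (intro mult_mono FK N) (use K0 in auto)
        then show "\<bar>vol g z\<bar> \<le> K * N"
          using K0 N(1) by (auto simp: vol_def abs_mult indicator_def)
      next
        fix z assume "z \<notin> C" then show "vol g z = 0" by (simp add: vol_def g)
      qed
    qed
    have gt0: "gt z = 0" and gx0: "gx z = 0" if "z \<notin> C" for z
      using C0(2)[OF that] by (simp_all add: gt_def gx_def)
    have lhs: "set_lebesgue_integral (lborel :: (real \<times> plane \<times> plane) measure) ({0<..} \<times> Omega \<times> UNIV)
          (\<lambda>(t, x, v). f x v * D (t, x, v) (1, v, 0)) = integral\<^sup>L lborel (vol gt) + integral\<^sup>L lborel (vol gx)"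
    proof -
      have "indicator ({0<..} \<times> Omega \<times> UNIV) z *\<^sub>R (case z of (t, x, v) \<Rightarrow> f x v * D (t, x, v) (1, v, 0))
          = vol gt z + vol gx z" for z
      proof -
        obtain t x v where fields: "z = (t, x, v)" by (rule prod_cases3)
        show ?thesis
        proof (cases "0 < t \<and> x \<in> Omega")
          case True
          then show ?thesis using f[of x v] by (simp add: fields vol_def lin F_def algebra_simps)
        next
          case False
          then have "x \<notin> Omega \<or> z \<notin> C" using C(2)[of z] by (auto simp: fields)
          then show ?thesis using False by (auto simp: fields vol_def gt0 gx0)
        qed
      qed
      then show ?thesis
        unfolding set_lebesgue_integral_def
        using Bochner_Integration.integral_add[OF vol_int[OF gtc gt0] vol_int[OF gxc gx0]] by simp
    qed
    have time: "integral\<^sup>L lborel (vol gt) = 0"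
    proof -
      have i: "integrable (lborel \<Otimes>\<^sub>M lborel) (\<lambda>(t, w). vol gt (t, w))"
        using vol_int[OF gtc gt0] by (simp add: lborel_prod case_prod_unfold)
      have zero: "(LINT t|lborel. gt (t, w)) = 0" for w
      proof -
        have out: "(t, w) \<notin> C" if "\<bar>t\<bar> > R" for t
        proof
          assume "(t, w) \<in> C"
          from R(2)[OF this] norm_fst_le[of t w] that show False by simp
        qed
        have "(LINT t|lborel. gt (t, w)) = (LINT t|lborel. indicator {- (R + 1)..R + 1} t *\<^sub>R gt (t, w))"
        proof (rule Bochner_Integration.integral_cong[OF refl])
          fix t
          show "gt (t, w) = indicator {- (R + 1)..R + 1} t *\<^sub>R gt (t, w)"
          proof (cases "t \<in> {- (R + 1)..R + 1}")
            case False
            then have "R < \<bar>t\<bar>" by auto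
            from gt0[OF out[OF this]] show ?thesis by simp
          qed simp
        qed
        also have "\<dots> = \<phi> (R + 1, w) - \<phi> (- (R + 1), w)"
        proof (rule integral_FTC_atLeastAtMost)
          fix t :: real
          have "((\<lambda>t. \<phi> (t, w)) has_derivative (\<lambda>h. D (t, w) (h, 0))) (at t within {- (R + 1)..R + 1})"
            by (rule has_derivative_compose[where g = \<phi>, OF _ D]) (auto intro!: derivative_eq_intros)
          moreover have "(\<lambda>h. D (t, w) (h, 0)) = (\<lambda>h. h *\<^sub>R gt (t, w))"
          proof
            fix h :: real
            have "(h, 0) = h *\<^sub>R (1 :: real, 0 :: plane \<times> plane)" by simp
            then have "D (t, w) (h, 0) = h *\<^sub>R D (t, w) (1, 0)"
              by (simp only: linear_cmul[OF has_derivative_linear[OF D]])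
            then show "D (t, w) (h, 0) = h *\<^sub>R gt (t, w)" by (simp add: gt_def zero_prod_def)
          qed
          ultimately show "((\<lambda>t. \<phi> (t, w)) has_vector_derivative gt (t, w)) (at t within {- (R + 1)..R + 1})"
            by (simp only: has_vector_derivative_def)
        next
          show "continuous_on {- (R + 1)..R + 1} (\<lambda>t. gt (t, w))"
            by (rule continuous_on_compose2[OF gtc]) (auto intro!: continuous_intros)
        qed (use R in simp)
        also have "\<dots> = 0" using C0(1)[OF out[of "R + 1"]] C0(1)[OF out[of "- (R + 1)"]] R(1) by simp
        finally show ?thesis .
      qed
      have "integral\<^sup>L lborel (vol gt) = (LINT w|lborel. LINT t|lborel. vol gt (t, w))"
        using lborel_pair.integral_snd[OF i] by (simp add: lborel_prod case_prod_unfold)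
      also have "\<dots> = 0" by (simp add: vol_def zero)
      finally show ?thesis .
    qed
    define bs where "bs p n z = indicator {0..1} (fst (snd z)) *
        ((snd (snd z) \<bullet> n) * F (p (fst (snd z))) (snd (snd z)) * \<phi> (fst z, p (fst (snd z)), snd (snd z)))"
      for p :: "real \<Rightarrow> plane" and n :: plane and z :: "real \<times> real \<times> plane"
    have bs: "integrable lborel (bs p n)" "side_flux p n (\<lambda>t. f) \<phi> = integral\<^sup>L lborel (bs p n)"
      if p: "continuous_on UNIV p" "\<And>s. s \<in> {0..1} \<Longrightarrow> p s \<in> Omega" and n: "norm n = 1" for p n
    proof -
      have pm: "(\<lambda>z. p (fst (snd z))) \<in> (borel :: (real \<times> real \<times> plane) measure) \<rightarrow>\<^sub>M borel"
        by (rule measurable_compose[OF proj(2) borel_measurable_continuous_onI[OF p(1)]])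
      have "continuous_on UNIV (\<lambda>z :: real \<times> real \<times> plane. p (fst (snd z)))"
        by (rule continuous_on_compose2[OF p(1)]) (auto intro!: continuous_intros)
      then have "continuous_on UNIV (\<lambda>z :: real \<times> real \<times> plane. \<phi> (fst z, p (fst (snd z)), snd (snd z)))"
        by (intro continuous_on_compose2[OF \<phi>c, where f = "\<lambda>z. (fst z, p (fst (snd z)), snd (snd z))"])
          (auto intro!: continuous_intros)
      note \<phi>m = borel_measurable_continuous_onI[OF this]
      show "integrable lborel (bs p n)"
      proof (rule integrable_bounded_compact_support[where C = "{- R..R} \<times> {0..1} \<times> cball 0 R"])
        have "(\<lambda>z. indicator {0..1} (fst (snd z)) :: real) \<in> borel_measurable (borel :: (real \<times> real \<times> plane) measure)"
          by (rule measurable_compose[OF proj(2) borel_measurable_indicator]) simp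
        then show "bs p n \<in> borel_measurable borel"
          unfolding bs_def[abs_def]
          by (intro borel_measurable_times F_borel pm proj \<phi>m)
            (auto intro!: borel_measurable_continuous_onI continuous_intros)
        fix z :: "real \<times> real \<times> plane"
        assume "z \<in> {- R..R} \<times> {0..1} \<times> cball 0 R"
        then have "\<bar>snd (snd z) \<bullet> n\<bar> \<le> R"
          using Cauchy_Schwarz_ineq2[of "snd (snd z)" n] n by auto
        then have "\<bar>snd (snd z) \<bullet> n\<bar> * \<bar>F (p (fst (snd z))) (snd (snd z))\<bar> * \<bar>\<phi> (fst z, p (fst (snd z)), snd (snd z))\<bar> \<le> R * K * M"
          using R K0 by (intro mult_mono FK M) auto
        then show "\<bar>bs p n z\<bar> \<le> R * K * M"
          using R K0 M(1) by (auto simp: bs_def abs_mult indicator_def)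
      next
        fix z :: "real \<times> real \<times> plane"
        assume z: "z \<notin> {- R..R} \<times> {0..1} \<times> cball 0 R"
        show "bs p n z = 0"
        proof (cases "fst (snd z) \<in> {0..1}")
          case True
          have "(fst z, p (fst (snd z)), snd (snd z)) \<notin> C"
          proof
            assume "(fst z, p (fst (snd z)), snd (snd z)) \<in> C"
            from R(2)[OF this] have "norm (fst z, p (fst (snd z)), snd (snd z)) \<le> R" .
            then have "norm (fst z) \<le> R \<and> norm (snd (snd z)) \<le> R"
              using norm_fst_le[of "fst z" "(p (fst (snd z)), snd (snd z))"]
                norm_snd_le[of "(p (fst (snd z)), snd (snd z))" "fst z"] norm_snd_le[of "snd (snd z)" "p (fst (snd z))"]
              by linarith
            then show False using z True by (simp add: mem_Times_iff abs_le_iff)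
          qed
          then show ?thesis by (simp add: bs_def C0)
        qed (simp add: bs_def)
      qed (intro compact_Times compact_Icc compact_cball)
      have "indicator ({0<..} \<times> {0..1} \<times> UNIV) z *\<^sub>R (case z of (t, s, v) \<Rightarrow> (v \<bullet> n) * f (p s) v * \<phi> (t, p s, v))
          = bs p n z" for z
      proof -
        obtain t s v where fields: "z = (t, s, v)" by (rule prod_cases3)
        show ?thesis
        proof (cases "0 < t \<and> s \<in> {0..1}")
          case True
          then show ?thesis using f[OF p(2), of s v] by (simp add: fields bs_def F_def)
        next
          case False
          then have "s \<notin> {0..1} \<or> (t, p s, v) \<notin> C" using C(2)[of "(t, p s, v)"] by auto
          then show ?thesis using False by (auto simp: fields bs_def C0)
        qed
      qed
      then show "side_flux p n (\<lambda>t. f) \<phi> = integral\<^sup>L lborel (bs p n)"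
        unfolding side_flux_def set_lebesgue_integral_def by (simp only:)
    qed
    define tot where "tot z = bs (\<lambda>s. (s, 1)) (0, 1) z + bs (\<lambda>s. (s, 0)) (0, -1) z
        + bs (\<lambda>s. (1, s)) (1, 0) z + bs (\<lambda>s. (0, s)) (-1, 0) z" for z
    note bi = bs(1)[OF pc(1) side(1) nn(1)] bs(1)[OF pc(1) side(2) nn(2)] bs(1)[OF pc(2) side(3) nn(3)] bs(1)[OF pc(2) side(4) nn(4)]
    note be = bs(2)[OF pc(1) side(1) nn(1)] bs(2)[OF pc(1) side(2) nn(2)] bs(2)[OF pc(2) side(3) nn(3)] bs(2)[OF pc(2) side(4) nn(4)]
    have tot_int: "integrable lborel tot"
      unfolding tot_def[abs_def] by (intro Bochner_Integration.integrable_add bi)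
    have tot_eq: "integral\<^sup>L lborel tot = side_flux (\<lambda>s. (s, 1)) (0, 1) (\<lambda>t. f) \<phi> + side_flux (\<lambda>s. (s, 0)) (0, -1) (\<lambda>t. f) \<phi>
          + side_flux (\<lambda>s. (1, s)) (1, 0) (\<lambda>t. f) \<phi> + side_flux (\<lambda>s. (0, s)) (-1, 0) (\<lambda>t. f) \<phi>"
    proof -
      have "integral\<^sup>L lborel tot = integral\<^sup>L lborel (bs (\<lambda>s. (s, 1)) (0, 1)) + integral\<^sup>L lborel (bs (\<lambda>s. (s, 0)) (0, -1))
          + integral\<^sup>L lborel (bs (\<lambda>s. (1, s)) (1, 0)) + integral\<^sup>L lborel (bs (\<lambda>s. (0, s)) (-1, 0))"
        unfolding tot_def[abs_def] using bi by simp
      then show ?thesis using be by linarith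
    qed
    have "integral\<^sup>L lborel (vol gx) = integral\<^sup>L lborel tot"
    proof (rule integral_eq_by_slices[OF vol_int[OF gxc gx0] tot_int])
      fix t :: real
      show "AE v in lborel. (LINT x|lborel. vol gx (t, x, v)) = (LINT s|lborel. tot (t, s, v))"
        using AE_plane_snd_nonzero
      proof eventually_elim
        case (elim v)
        have Hv: "H v \<in> borel_measurable borel"
        proof -
          have "(\<lambda>y. (v, y)) \<in> (borel :: real measure) \<rightarrow>\<^sub>M borel"
            by (auto intro!: borel_measurable_continuous_onI continuous_intros)
          from measurable_compose[OF this H] show ?thesis by simp
        qed
        have HK: "\<bar>H v y\<bar> \<le> K" for y
          using bound[of v y] K0 by (auto intro!: order_trans[OF bound] mult_left_le)
        have d: "((\<lambda>x. \<phi> (t, x, v)) has_derivative (\<lambda>h. D (t, x, v) (0, h, 0))) (at x)" for x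
          by (rule has_derivative_compose[where g = \<phi>, OF _ D]) (auto intro!: derivative_eq_intros)
        have c: "continuous_on UNIV (\<lambda>x. D (t, x, v) (0, h, 0))" for h
          by (rule continuous_on_compose2[OF Dc]) (auto intro!: continuous_intros)
        have "(LINT x|lborel. vol gx (t, x, v)) =
          (LINT x:Omega|lborel. H v (fst x - snd x * (fst v / snd v)) * D (t, x, v) (0, v, 0))"
          by (simp add: set_lebesgue_integral_def vol_def F_def gx_def)
        also have "\<dots> = (LINT s|lborel. tot (t, s, v))"
        proof (subst green_square_constant_along_lines[OF Hv HK d c elim], unfold set_lebesgue_integral_def,
            rule Bochner_Integration.integral_cong[OF refl])
          fix s :: real
          show "indicator {0..1} s *\<^sub>R (snd v * (H v (s - fst v / snd v) * \<phi> (t, (s, 1), v) - H v s * \<phi> (t, (s, 0), v))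
              + fst v * (H v (1 - s * (fst v / snd v)) * \<phi> (t, (1, s), v)
                - H v (- (s * (fst v / snd v))) * \<phi> (t, (0, s), v))) = tot (t, s, v)"
            by (simp add: tot_def bs_def F_def inner_prod_def distrib_left right_diff_distrib)
        qed
        finally show ?case .
      qed
    qed
    then show ?thesis
      using lhs time tot_eq unfolding D_def by linarith
  qed
  show ?thesis
    unfolding weak_free_transport_def
    using interior green sides[OF pc(1) side(1) nn(1)] sides[OF pc(1) side(2) nn(2)]
      sides[OF pc(2) side(3) nn(3)] sides[OF pc(2) side(4) nn(4)] by simp
qed

section \<open>The candidate density\<close>

text \<open>The density at velocity \<open>v\<close> on the line that meets the lower wall at \<open>x\<^sub>1 = y\<close>, when \<open>S y\<close> is the
temperature of the reflected Maxwellian there.\<close>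

definition line_profile :: "(real \<Rightarrow> real) \<Rightarrow> plane \<Rightarrow> real \<Rightarrow> real" where
  "line_profile S v y = indicat_real {v. snd v < 0} v * wall_maxwellian 1 v
     + indicat_real {v. 0 < snd v} v * wall_maxwellian (S y) v"

lemma measurable_line_profile_pair:
  assumes "S \<in> borel_measurable borel"
  shows "(\<lambda>(v, y). line_profile S v y) \<in> borel_measurable borel"
proof -
  have p: "fst \<in> (borel :: (plane \<times> real) measure) \<rightarrow>\<^sub>M borel" "snd \<in> (borel :: (plane \<times> real) measure) \<rightarrow>\<^sub>M borel"
    by (auto intro!: borel_measurable_continuous_onI continuous_intros)
  have "(\<lambda>z. line_profile S (fst z) (snd z)) \<in> borel_measurable borel"
    unfolding line_profile_def
    by (intro borel_measurable_add borel_measurable_times measurable_wall_maxwellian p borel_measurable_const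
      measurable_compose[OF p(2) assms] measurable_compose[OF p(1) borel_measurable_indicator] half_planes_borel)
  then show ?thesis by (simp add: case_prod_unfold)
qed

lemma line_profile_bounds:
  assumes c: "0 < c" "c \<le> S y" "S y \<le> 1"
  shows "\<bar>line_profile S v y\<bar> \<le> exp (- ((norm v)\<^sup>2 / 2)) / (c * sqrt (2 * pi * c))"
    and "0 \<le> line_profile S v y" and "snd v \<noteq> 0 \<Longrightarrow> 0 < line_profile S v y"
proof -
  have S: "0 < S y" using c by linarith
  show "0 \<le> line_profile S v y"
    by (simp add: line_profile_def indicator_def wall_maxwellian_nonneg S)
  show "0 < line_profile S v y" if "snd v \<noteq> 0"
    using that wall_maxwellian_pos[OF S, of v] wall_maxwellian_pos[of 1 v] by (simp add: line_profile_def indicator_def)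
  have "c \<le> 1" using c by linarith
  then show "\<bar>line_profile S v y\<bar> \<le> exp (- ((norm v)\<^sup>2 / 2)) / (c * sqrt (2 * pi * c))"
    using wall_maxwellian_le[OF c, of v] wall_maxwellian_le[OF c(1), of 1 v] wall_maxwellian_nonneg[OF S, of v]
      wall_maxwellian_nonneg[of 1 v] c(1)
    by (auto simp: line_profile_def indicator_def)
qed

text \<open>The backward trajectory from \<open>x\<close> takes the time \<open>x\<^sub>2 / v\<^sub>2\<close> to reach the lower wall. This holds also
for \<open>x\<^sub>2 = 0\<close>, where \<open>sigma_tilde\<close> falls through to its last case.\<close>

lemma f_infty_eq_line_profile:
  assumes T2: "\<And>x. x \<in> {0..1} \<times> {0} \<Longrightarrow> 0 < T\<^sub>2 x"
    and r: "0 < r" "r < 1" and p: "p * (2 - p) = r" and x: "x \<in> Omega"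
  shows "f_infty T\<^sub>2 r p \<beta> x v
    = \<beta> * line_profile (\<lambda>y. 1 - r + r * T\<^sub>2 (y - of_int \<lfloor>y\<rfloor>, 0)) v (fst x - snd x * (fst v / snd v))"
proof -
  define y where "y = fst x - snd x * (fst v / snd v)"
  have up: "(LINT u:{u. snd u < 0}|lborel. (- snd u) * CL_kernel r p (T\<^sub>2 (q_tilde x (- v))) u v
      * (exp (- ((norm u)\<^sup>2 / 2)) / sqrt (2 * pi))) = wall_maxwellian (1 - r + r * T\<^sub>2 (y - of_int \<lfloor>y\<rfloor>, 0)) v"
    if v: "0 < snd v"
  proof -
    have x2: "0 \<le> snd x" "snd x \<le> 1" using x by (auto simp: Omega_def)
    have "sigma_tilde x (- v) = snd x / snd v"
    proof (cases "snd x = 0")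
      case True
      then show ?thesis using v by (simp add: sigma_tilde_def)
    next
      case False
      then have "{t. 0 < t \<and> snd x + t * snd (- v) = 0} = {snd x / snd v}"
        using v x2 by (auto simp: field_simps)
      then show ?thesis using False v x2 by (simp add: sigma_tilde_def)
    qed
    then have q: "q_tilde x (- v) = (y - of_int \<lfloor>y\<rfloor>, 0)"
      using v by (simp add: q_tilde_def y_def)
    have "(y - of_int \<lfloor>y\<rfloor>, 0) \<in> {0..1} \<times> {0 :: real}" by simp linarith
    then show ?thesis unfolding q by (intro CL_reflects_maxwellian T2 r p v)
  qed
  show ?thesis
  proof (cases "0 < snd v")
    case True
    then show ?thesis unfolding f_infty_def y_def[symmetric] up[OF True] by (simp add: line_profile_def)
  next
    case False
    then show ?thesis by (simp add: f_infty_def line_profile_def wall_maxwellian_def)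
  qed
qed

lemma set_integrable_phase_space:
  fixes u :: "plane \<times> plane \<Rightarrow> real"
  assumes u: "u \<in> borel_measurable borel" and le: "\<And>x v. \<bar>u (x, v)\<bar> \<le> K * exp (- ((norm v)\<^sup>2 / 2))"
  shows "set_integrable lborel (Omega \<times> UNIV) u"
proof -
  have K: "0 \<le> K" using le[of 0 0] by simp
  from integrable_compact_times_gaussian[OF Omega_compact, of K] show ?thesis
    unfolding set_integrable_def
  proof (rule Bochner_Integration.integrable_bound)
    have "Omega \<times> UNIV \<in> sets (borel :: (plane \<times> plane) measure)"
      by (rule borel_closed[OF closed_Times[OF compact_imp_closed[OF Omega_compact] closed_UNIV]])
    then show "(\<lambda>z. indicator (Omega \<times> UNIV) z *\<^sub>R u z) \<in> borel_measurable lborel"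
      using u by simp
    show "AE z in lborel. norm (indicator (Omega \<times> UNIV) z *\<^sub>R u z)
      \<le> norm (indicator Omega (fst z) * (K * ((1 + norm (snd z)) * exp (- ((norm (snd z))\<^sup>2 / 2)))))"
    proof (rule AE_I2)
      fix z :: "plane \<times> plane"
      obtain x v where z: "z = (x, v)" by (rule prod.exhaust)
      have "\<bar>u (x, v)\<bar> \<le> 1 * (K * exp (- ((norm v)\<^sup>2 / 2)))" using le by simp
      also have "\<dots> \<le> (1 + norm v) * (K * exp (- ((norm v)\<^sup>2 / 2)))"
        using K by (intro mult_right_mono) auto
      finally have "\<bar>u (x, v)\<bar> \<le> K * ((1 + norm v) * exp (- ((norm v)\<^sup>2 / 2)))" by (simp only: mult_ac)
      from order_trans[OF this abs_ge_self]
      show "norm (indicator (Omega \<times> UNIV) z *\<^sub>R u z)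
          \<le> norm (indicator Omega (fst z) * (K * ((1 + norm (snd z)) * exp (- ((norm (snd z))\<^sup>2 / 2)))))"
        by (cases "x \<in> Omega") (simp_all add: z)
    qed
  qed
qed

text \<open>The density is positive on a nonempty open set.\<close>

lemma line_profile_mass_positive:
  assumes S: "S \<in> borel_measurable borel" and c: "0 < c" "\<And>y. c \<le> S y" "\<And>y. S y \<le> 1"
  shows "0 < total_mass (\<lambda>x v. line_profile S v (fst x - snd x * (fst v / snd v)))"
proof -
  define P where "P z = line_profile S (snd z) (fst (fst z) - snd (fst z) * (fst (snd z) / snd (snd z)))" for z :: "plane \<times> plane"
  have P0: "0 \<le> P z" for z unfolding P_def by (rule line_profile_bounds(2)[where S = S, OF c(1) c(2) c(3)])
  have "P \<in> borel_measurable borel"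
    unfolding P_def[abs_def]
    by (rule measurable_line_profile[OF measurable_line_profile_pair[OF S]])
      (auto intro!: borel_measurable_continuous_onI continuous_intros)
  moreover have "\<bar>P (x, v)\<bar> \<le> 1 / (c * sqrt (2 * pi * c)) * exp (- ((norm v)\<^sup>2 / 2))" for x v
    using line_profile_bounds(1)[where S = S, OF c(1) c(2) c(3)] by (simp add: P_def)
  ultimately have i: "integrable lborel (\<lambda>z. indicator (Omega \<times> UNIV) z *\<^sub>R P z)"
    using set_integrable_phase_space unfolding set_integrable_def by blast
  have "(LINT z|lborel. indicator (Omega \<times> UNIV) z *\<^sub>R P z) \<noteq> 0"
  proof
    assume "(LINT z|lborel. indicator (Omega \<times> UNIV) z *\<^sub>R P z) = 0"
    then have ae: "AE z in lborel. indicator (Omega \<times> UNIV) z *\<^sub>R P z = 0"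
      using integral_nonneg_eq_0_iff_AE[OF i] P0 by simp
    define U :: "(plane \<times> plane) set" where "U = ({0<..<1} \<times> {0<..<1}) \<times> (UNIV \<times> {0<..})"
    have "open U" unfolding U_def by (intro open_Times) auto
    have "AE z in lborel. z \<notin> U"
      using ae
    proof eventually_elim
      case (elim z)
      show ?case
      proof
        assume z: "z \<in> U"
        then have "snd (snd z) \<noteq> 0" by (auto simp: U_def)
        then have "0 < P z" unfolding P_def by (intro line_profile_bounds(3)[where S = S, OF c(1) c(2) c(3)])
        moreover have "z \<in> Omega \<times> UNIV" using z by (auto simp: U_def Omega_def)
        ultimately show False using elim by simp
      qed
    qed
    then have "U \<in> null_sets lborel"
      using \<open>open U\<close> by (simp add: AE_iff_null_sets)
    then have "negligible U" by (simp add: negligible_iff_null_sets null_sets_completionI)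
    moreover have "((1/2, 1/2), (0, 1)) \<in> U" by (simp add: U_def)
    ultimately show False using open_not_negligible[OF \<open>open U\<close>] by blast
  qed
  moreover have "0 \<le> (LINT z|lborel. indicator (Omega \<times> UNIV) z *\<^sub>R P z)"
    using P0 by (intro integral_nonneg_AE) (simp add: indicator_def)
  ultimately show ?thesis by (simp add: total_mass_def set_lebesgue_integral_def P_def)
qed

text \<open>As seen from a fixed point \<open>(a, b)\<close>, the starting point on the wall depends on the slope of \<open>v\<close> only,
so \<open>half_plane_moments\<close> applies: the upward flux 1 balances the downward flux of the upper wall, and
the tangential momentum vanishes on each half plane.\<close>

lemma line_profile_momentum:
  assumes S: "S \<in> borel_measurable borel" and c: "0 < c" "\<And>y. c \<le> S y" "\<And>y. S y \<le> 1"
  shows "(LINT v:{v. 0 < snd v}|lborel. snd v * line_profile S v (a - b * (fst v / snd v))) = 1"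
    and "has_bochner_integral lborel (\<lambda>v. line_profile S v (a - b * (fst v / snd v)) *\<^sub>R v) 0"
proof -
  define \<theta> where "\<theta> m = S (a - b * m)" for m
  have \<theta>: "\<theta> \<in> borel_measurable borel" unfolding \<theta>_def[abs_def]
    by (rule measurable_compose[OF _ S]) simp
  have \<theta>c: "c \<le> \<theta> m" "\<theta> m \<le> 1" for m using c by (simp_all add: \<theta>_def)
  note up = half_plane_moments[OF \<theta> c(1) \<theta>c]
  note lo = half_plane_moments[of "\<lambda>_. 1" 1, simplified]
  define L where "L v = line_profile S v (a - b * (fst v / snd v))" for v
  have L: "L v = indicator {v. snd v < 0} v * wall_maxwellian 1 v
      + indicator {v. 0 < snd v} v * wall_maxwellian (\<theta> (fst v / snd v)) v" for v
    by (simp add: L_def line_profile_def \<theta>_def)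
  show "(LINT v:{v. 0 < snd v}|lborel. snd v * line_profile S v (a - b * (fst v / snd v))) = 1"
    unfolding L_def[symmetric] up(1)[symmetric]
    by (rule set_lebesgue_integral_cong) (auto simp: L)
  have comp: "has_bochner_integral lborel (\<lambda>v. q v * L v) (l + u)"
    if "integrable lborel (\<lambda>v. q v * wall_maxwellian 1 v)"
      "(LINT v:{v. snd v < 0}|lborel. q v * wall_maxwellian 1 v) = l"
      "integrable lborel (\<lambda>v. q v * wall_maxwellian (\<theta> (fst v / snd v)) v)"
      "(LINT v:{v. 0 < snd v}|lborel. q v * wall_maxwellian (\<theta> (fst v / snd v)) v) = u"
    for q :: "plane \<Rightarrow> real" and l u
  proof -
    have "has_bochner_integral lborel (\<lambda>v. indicator {v. snd v < 0} v *\<^sub>R (q v * wall_maxwellian 1 v)) l"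
      using integrable_mult_indicator[of "{v. snd v < 0}", OF _ that(1)] that(2) half_planes_borel
      unfolding set_lebesgue_integral_def by (simp add: has_bochner_integral_iff)
    moreover have "has_bochner_integral lborel
        (\<lambda>v. indicator {v. 0 < snd v} v *\<^sub>R (q v * wall_maxwellian (\<theta> (fst v / snd v)) v)) u"
      using integrable_mult_indicator[of "{v. 0 < snd v}", OF _ that(3)] that(4) half_planes_borel
      unfolding set_lebesgue_integral_def by (simp add: has_bochner_integral_iff)
    ultimately show ?thesis
      using has_bochner_integral_add by (fastforce simp: L algebra_simps)
  qed
  have "has_bochner_integral lborel (\<lambda>v. (fst v * L v) *\<^sub>R (1, 0) + (snd v * L v) *\<^sub>R (0, 1))
      ((0 + 0) *\<^sub>R (1, 0) + (- 1 + 1) *\<^sub>R (0, 1) :: plane)"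
    by (intro has_bochner_integral_add has_bochner_integral_scaleR_left comp up lo)
  moreover have "(fst v * L v) *\<^sub>R (1, 0) + (snd v * L v) *\<^sub>R (0, 1) = L v *\<^sub>R v" for v
    by (simp add: prod_eq_iff)
  ultimately show "has_bochner_integral lborel (\<lambda>v. line_profile S v (a - b * (fst v / snd v)) *\<^sub>R v) 0"
    unfolding L_def by (simp add: zero_prod_def)
qed

lemma AE_wall_coordinate: "AE z in (lborel :: (real \<times> real \<times> plane) measure). fst (snd z) \<noteq> a"
proof -
  have "AE y in (lborel \<Otimes>\<^sub>M lborel) :: (real \<times> plane) measure. fst y \<noteq> a"
  proof (rule lborel_pair.AE_pair_measure)
    show "{y \<in> space (lborel \<Otimes>\<^sub>M (lborel :: plane measure)). fst y \<noteq> a} \<in> sets (lborel \<Otimes>\<^sub>M lborel)"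
      by measurable
    show "AE s in lborel. AE v in (lborel :: plane measure). fst (s, v) \<noteq> a"
      using AE_lborel_singleton[of a] by eventually_elim simp
  qed
  then have y: "AE y in (lborel :: (real \<times> plane) measure). fst y \<noteq> a" unfolding lborel_prod .
  have "AE z in (lborel \<Otimes>\<^sub>M lborel) :: (real \<times> real \<times> plane) measure. fst (snd z) \<noteq> a"
  proof (rule lborel_pair.AE_pair_measure)
    have "fst \<in> (borel :: (real \<times> plane) measure) \<rightarrow>\<^sub>M borel"
      by (auto intro!: borel_measurable_continuous_onI continuous_intros)
    note [measurable] = measurable_compose[OF measurable_snd this]
    show "{z \<in> space (lborel \<Otimes>\<^sub>M (lborel :: (real \<times> plane) measure)). fst (snd z) \<noteq> a} \<in> sets (lborel \<Otimes>\<^sub>M lborel)"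
      by measurable
    show "AE t in lborel. AE y in lborel. fst (snd (t, y :: real \<times> plane)) \<noteq> a"
      using y by simp
  qed
  then show ?thesis unfolding lborel_prod .
qed

text \<open>The temperature of the Maxwellian emitted upwards, \<open>S\<close> below, is extended periodically along the lower
wall. At \<open>x\<^sub>1 = 1\<close> the wrapping picks the temperature at \<open>x\<^sub>1 = 0\<close>, so the lower boundary condition is
only verified for \<open>x\<^sub>1 \<noteq> 1\<close>, that is almost everywhere.\<close>

theorem theorem25:
  fixes T\<^sub>1 T\<^sub>2 :: "plane \<Rightarrow> real" and r_perp r_par :: real
  assumes T1: "\<And>x. x \<in> {0..1} \<times> {1} \<Longrightarrow> T\<^sub>1 x = 1"
    and T2_cont: "continuous_on ({0..1} \<times> {0}) T\<^sub>2"
    and T2: "\<And>x. x \<in> {0..1} \<times> {0} \<Longrightarrow> 0 < T\<^sub>2 x \<and> T\<^sub>2 x < 1"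
    and r_perp: "0 < r_perp" "r_perp < 1"
    and r_par: "0 < r_par" "r_par < 2"
    and r_eq: "r_par * (2 - r_par) = r_perp"
  shows "(\<exists>!\<beta>. 0 < \<beta> \<and> total_mass (f_infty T\<^sub>2 r_perp r_par \<beta>) = 1) \<and>
    (\<forall>\<beta>. 0 < \<beta> \<longrightarrow> total_mass (f_infty T\<^sub>2 r_perp r_par \<beta>) = 1 \<longrightarrow>
       steady_state T\<^sub>1 T\<^sub>2 r_perp r_par (f_infty T\<^sub>2 r_perp r_par \<beta>) \<and>
       (\<forall>x\<in>Omega. has_bochner_integral lborel (\<lambda>v. f_infty T\<^sub>2 r_perp r_par \<beta> x v *\<^sub>R v) 0))"
proof -
  define S where "S y = 1 - r_perp + r_perp * T\<^sub>2 (y - of_int \<lfloor>y\<rfloor>, 0)" for y :: real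
  define P where "P x v = line_profile S v (fst x - snd x * (fst v / snd v))" for x v
  define c where "c = 1 - r_perp"
  have wall: "(y - of_int \<lfloor>y\<rfloor>, 0) \<in> {0..1} \<times> {0 :: real}" for y :: real by simp linarith
  have c: "0 < c" "c \<le> S y" "S y \<le> 1" for y
  proof -
    have t: "0 < T\<^sub>2 (y - of_int \<lfloor>y\<rfloor>, 0)" "T\<^sub>2 (y - of_int \<lfloor>y\<rfloor>, 0) < 1" using T2[OF wall[of y]] by auto
    show "0 < c" using r_perp by (simp add: c_def)
    show "c \<le> S y" using t r_perp by (simp add: c_def S_def)
    have "r_perp * T\<^sub>2 (y - of_int \<lfloor>y\<rfloor>, 0) \<le> r_perp * 1" using t r_perp by (intro mult_left_mono) auto
    then show "S y \<le> 1" by (simp add: S_def)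
  qed
  have S: "S \<in> borel_measurable borel"
  proof -
    have "(\<lambda>y::real. (y - of_int \<lfloor>y\<rfloor>, 0 :: real)) \<in> borel \<rightarrow>\<^sub>M restrict_space borel ({0..1} \<times> {0})"
      by (rule measurable_restrict_space2) (use wall in \<open>auto intro!: borel_measurable_Pair\<close>)
    from measurable_compose[OF this borel_measurable_continuous_on_restrict[OF T2_cont]]
    show ?thesis unfolding S_def[abs_def] by simp
  qed
  have S_periodic: "S (y + 1) = S y" for y
    by (simp add: S_def)
  have f: "f_infty T\<^sub>2 r_perp r_par \<beta> x v = \<beta> * P x v" if "x \<in> Omega" for \<beta> x v
    using f_infty_eq_line_profile[OF _ r_perp r_eq that, of T\<^sub>2 \<beta> v] T2 by (simp add: P_def S_def[abs_def])
  have mass: "total_mass (f_infty T\<^sub>2 r_perp r_par \<beta>) = \<beta> * total_mass P" for \<beta>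
  proof -
    have "total_mass (f_infty T\<^sub>2 r_perp r_par \<beta>) = (LINT z:Omega \<times> UNIV|lborel. \<beta> * P (fst z) (snd z))"
      unfolding total_mass_def set_lebesgue_integral_def
      by (rule Bochner_Integration.integral_cong) (auto simp: f indicator_def)
    then show ?thesis by (simp add: total_mass_def)
  qed
  have mass_pos: "0 < total_mass P"
    unfolding P_def[abs_def] by (rule line_profile_mass_positive[OF S c])
  have unique: "\<exists>!\<beta>. 0 < \<beta> \<and> total_mass (f_infty T\<^sub>2 r_perp r_par \<beta>) = 1"
    unfolding mass using mass_pos by (intro ex1I[of _ "1 / total_mass P"]) (auto simp: field_simps)
  have steady: "steady_state T\<^sub>1 T\<^sub>2 r_perp r_par (f_infty T\<^sub>2 r_perp r_par \<beta>)" if \<beta>: "0 < \<beta>" for \<beta>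
  proof -
    let ?f = "f_infty T\<^sub>2 r_perp r_par \<beta>"
    have weak: "weak_free_transport (\<lambda>t. ?f)"
    proof (rule weak_free_transport_line_profile)
      show "(\<lambda>(v, y). \<beta> * line_profile S v y) \<in> borel_measurable borel"
        using borel_measurable_times[OF borel_measurable_const[of \<beta>] measurable_line_profile_pair[OF S]]
        by (simp add: case_prod_unfold)
      show "\<bar>\<beta> * line_profile S v y\<bar> \<le> \<beta> / (c * sqrt (2 * pi * c)) * exp (- ((norm v)\<^sup>2 / 2))" for v y
        using mult_left_mono[OF line_profile_bounds(1)[where S = S, OF c, of v y], of \<beta>] \<beta> by (simp add: abs_mult)
      show "?f x v = \<beta> * line_profile S v (fst x - snd x * (fst v / snd v))" if "x \<in> Omega" for x v
        using f[OF that] by (simp add: P_def)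
    qed
    have periodic: "periodic_bc (\<lambda>t. ?f)"
    proof -
      have "?f (0, y) v = ?f (1, y) v" if "y \<in> {0..1}" for y v
        using that S_periodic[of "- (y * fst v / snd v)"]
        by (subst (1 2) f) (auto simp: Omega_def P_def line_profile_def add.commute)
      then show ?thesis unfolding periodic_bc_def by (intro AE_I2) auto
    qed
    have diffuse: "diffuse_bc T\<^sub>1 (\<lambda>t. ?f)"
    proof -
      have "?f (s, 1) v = exp (- ((norm v)\<^sup>2 / (2 * T\<^sub>1 (s, 1)))) / (T\<^sub>1 (s, 1) * sqrt (2 * pi * T\<^sub>1 (s, 1)))
            * (LINT w:{w. snd w > 0}|lborel. snd w * ?f (s, 1) w)"
        if s: "s \<in> {0..1}" and v: "snd v < 0" for s v
      proof -
        have \<Omega>: "(s, 1) \<in> Omega" using s by (simp add: Omega_def)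
        have "(LINT w:{w. snd w > 0}|lborel. snd w * ?f (s, 1) w)
            = \<beta> * (LINT w:{w. snd w > 0}|lborel. snd w * line_profile S w (s - 1 * (fst w / snd w)))"
          unfolding f[OF \<Omega>] P_def by (simp add: mult.left_commute[of _ \<beta>])
        also have "\<dots> = \<beta>" unfolding line_profile_momentum(1)[OF S c] by simp
        finally show ?thesis
          using v T1[of "(s, 1)"] s by (simp add: f[OF \<Omega>] P_def line_profile_def wall_maxwellian_def)
      qed
      then show ?thesis unfolding diffuse_bc_def by (intro AE_I2) auto
    qed
    have CL: "CL_bc r_perp r_par T\<^sub>2 (\<lambda>t. ?f)"
    proof -
      have "?f (s, 0) v = (LINT w:{w. snd w < 0}|lborel.
               (- snd w) * CL_kernel r_perp r_par (T\<^sub>2 (s, 0)) w v * ?f (s, 0) w)"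
        if s: "s \<in> {0..1}" "s \<noteq> 1" and v: "0 < snd v" for s v
      proof -
        have \<Omega>: "(s, 0) \<in> Omega" using s by (simp add: Omega_def)
        have fl: "\<lfloor>s\<rfloor> = 0" using s by (simp add: floor_eq_iff)
        have "(LINT w:{w. snd w < 0}|lborel. (- snd w) * CL_kernel r_perp r_par (T\<^sub>2 (s, 0)) w v * ?f (s, 0) w)
          = (LINT w:{w. snd w < 0}|lborel. \<beta> * ((- snd w) * CL_kernel r_perp r_par (T\<^sub>2 (s, 0)) w v
              * (exp (- ((norm w)\<^sup>2 / 2)) / sqrt (2 * pi))))"
          by (rule set_lebesgue_integral_cong)
            (auto simp: half_planes_borel f[OF \<Omega>] P_def line_profile_def wall_maxwellian_def)
        also have "\<dots> = \<beta> * wall_maxwellian (1 - r_perp + r_perp * T\<^sub>2 (s, 0)) v"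
        proof -
          have "0 < T\<^sub>2 (s, 0)" using T2[of "(s, 0)"] s by simp
          then show ?thesis unfolding set_integral_mult_right by (subst CL_reflects_maxwellian[OF _ r_perp r_eq v]) auto
        qed
        also have "\<dots> = ?f (s, 0) v"
          using v by (simp add: f[OF \<Omega>] P_def line_profile_def S_def fl)
        finally show ?thesis ..
      qed
      then have "0 < fst z \<longrightarrow> fst (snd z) \<in> {0..1} \<longrightarrow> snd (snd (snd z)) > 0 \<longrightarrow>
          ?f (fst (snd z), 0) (snd (snd z)) = (LINT w:{w. snd w < 0}|lborel.
               (- snd w) * CL_kernel r_perp r_par (T\<^sub>2 (fst (snd z), 0)) w (snd (snd z)) * ?f (fst (snd z), 0) w)"
        if "fst (snd z) \<noteq> 1" for z :: "real \<times> real \<times> plane"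
        using that by blast
      then show ?thesis
        unfolding CL_bc_def case_prod_unfold
        by (rule eventually_mono[OF AE_wall_coordinate[of 1]])
    qed
    show ?thesis
      unfolding steady_state_def mixed_transport_solution_def using weak periodic diffuse CL by blast
  qed
  have momentum: "has_bochner_integral lborel (\<lambda>v. f_infty T\<^sub>2 r_perp r_par \<beta> x v *\<^sub>R v) 0" if "x \<in> Omega" for \<beta> x
    using has_bochner_integral_scaleR_right[OF line_profile_momentum(2)[OF S c, of "fst x" "snd x"], of \<beta>]
    by (simp add: f[OF that] P_def)
  show ?thesis using unique steady momentum by blast
qed

end
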